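(* Let $D=D_0$ be the open unit disk. In the coordinates $(\xi,I)\in\mathbb{R}/2\pi\mathbb{Z}\times(-I_c,I_c)$, where $\xi$ is the polar angle and $I=\sqrt{\mathcal{E}-\omega^2/2}\,\sin\alpha$ is the action (with $I_c=\sqrt{\mathcal{E}-\omega^2/2}$), which are action-angle coordinates, the first return map is the shift $$\mathcal{F}:\mathbb{R}/2\pi\mathbb{Z}\times(-I_c,I_c)\to\mathbb{R}/2\pi\mathbb{Z}\times(-I_c,I_c),\qquad (\xi_0,I_0)\mapsto(\xi_1,I_1)=(\xi_0+\bar\theta(I_0),I_0),$$ where $\bar\theta(I)=f(I)+g(I)$ and $$f(I)=\begin{cases}\operatorname{arccot}\left(\frac{\mathcal{E}-2I^2}{I\sqrt{4\mathcal{E}-2(2I^2+\omega^2)}}\right)&I\in(0,I_c)\\0&I=0\\ \operatorname{arccot}\left(\frac{\mathcal{E}-2I^2}{I\sqrt{4\mathcal{E}-2(2I^2+\omega^2)}}\right)-\pi&I\in(-I_c,0)\end{cases}$$ $$g(I)=\begin{cases}2\arccos\left(\frac{2I^2-\mu}{\sqrt{4(\mathcal{E}+h)I^2+\mu^2}}\right)-2\pi&I\in(0,I_c)\\0&I=0\\-2\arccos\left(\frac{2I^2-\mu}{\sqrt{4(\mathcal{E}+h)I^2+\mu^2}}\right)+2\pi&I\in(-I_c,0)\end{cases}$$ are real analytic functions in $(-I_c,I_c)$. Moreover, for every $I\in(-I_c,I_c)$, except for a finite number (at most ten) of points, $\bar\theta'(I)\neq0$.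
   Context: Fix real parameters with $\omega>0$, $\mathcal{E}>\omega^2$, $h>0$, $\mu>0$. Put $V_I(z)=\mathcal{E}+h+\frac{\mu}{|z|}$ and $V_E(z)=\mathcal{E}-\frac{\omega^2}{2}|z|^2$ on $\mathbb{R}^2\simeq\mathbb{C}$ (minus the origin for $V_I$). The function $\operatorname{arccot}$ takes values in $(0,\pi)$ and $\arccos$ in $[0,\pi]$. An outer arc is a solution of $z''=\nabla V_E(z)$, $\frac12|z'|^2=V_E(z)$ lying outside $\overline{D_0}$ except for its endpoints, which are on $\partial D_0$. An inner arc is a solution of $z''=\nabla V_I(z)$, $\frac12|z'|^2=V_I(z)$ lying in $D_0$ except for its endpoints, which are on $\partial D_0$; radial inner arcs are continued (Levi-Civita regularization) as ejection-collision arcs, which fall into the origin and go back along the same segment. When a trajectory crosses $\partial D_0$ at a point $p$ it is refracted according to Snell's law $\sqrt{V_E(p)}\sin\alpha_E=\sqrt{V_I(p)}\sin\alpha_I$, where $\alpha_E,\alpha_I$ are the angles of the outer and inner velocity with the normal to $\partial D_0$ at $p$ (equivalently, the tangential component of the velocity is preserved). First return map: given $\xi_0\in\mathbb{R}/2\pi\mathbb{Z}$ and $\alpha_0\in(-\pi/2,\pi/2)$, follow the outer arc starting at $e^{i\xi_0}$ with velocity $\sqrt{2V_E(e^{i\xi_0})}(\cos\alpha_0\,n+\sin\alpha_0\,t)$, where $n=e^{i\xi_0}$ and $t=ie^{i\xi_0}$ are the outward normal and the tangent unit vectors, up to its next point on $\partial D_0$; refract inward; follow the inner arc up to its next point $e^{i\xi_1}\in\partial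 D_0$; refract outward, obtaining an outgoing velocity forming the angle $\alpha_1$ with the outward normal at $e^{i\xi_1}$ (same sign convention). The first return map sends $(\xi_0,\alpha_0)$ to $(\xi_1,\alpha_1)$; in the action coordinates $I_j=\sqrt{\mathcal{E}-\omega^2/2}\,\sin\alpha_j$ it is denoted $\mathcal{F}$. *)

theory Defs
  imports "HOL-Analysis.Analysis" "HOL-Library.Real_Mod"
begin

section \<open>Real functions\<close>

definition real_analytic_on :: "(real \<Rightarrow> real) \<Rightarrow> real set \<Rightarrow> bool" where
  "real_analytic_on f S \<longleftrightarrow>
     (\<forall>x\<in>S. \<exists>r>0. \<exists>a. \<forall>y. \<bar>y - x\<bar> < r \<longrightarrow> (\<lambda>n. a n * (y - x) ^ n) sums f y)"

definition arccot :: "real \<Rightarrow> real" where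
  "arccot x = (THE y. 0 < y \<and> y < pi \<and> cot y = x)"

section \<open>The circle of angles\<close>

text \<open>The circle \<open>\<real>/2\<pi>\<int>\<close>; \<open>abs_angle x\<close> is the class of the real number \<open>x\<close>.\<close>

quotient_type angle = real / "\<lambda>x y::real. [x = y] (rmod (2 * pi))"
  by (intro equivpI reflpI sympI transpI) (auto intro: rcong_sym rcong_trans)

lift_definition circle_point :: "angle \<Rightarrow> complex" is cis
  by (simp add: cis_eq_iff)

section \<open>Motions and arcs\<close>

definition V_E :: "real \<Rightarrow> real \<Rightarrow> complex \<Rightarrow> real" where
  "V_E \<omega> \<E> z = \<E> - \<omega>\<^sup>2 / 2 * (norm z)\<^sup>2"

definition V_I :: "real \<Rightarrow> real \<Rightarrow> real \<Rightarrow> complex \<Rightarrow> real" where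
  "V_I \<E> h \<mu> z = \<E> + h + \<mu> / norm z"

text \<open>\<open>z\<close> solves \<open>z'' = \<nabla>V(z)\<close>, \<open>\<bar>z'\<bar>\<^sup>2 / 2 = V(z)\<close> on the time interval \<open>J\<close>, inside the
  domain \<open>S\<close> of the potential, and \<open>v\<close> is its velocity. Derivatives at the endpoints that belong
  to \<open>J\<close> are one-sided.\<close>

definition motion ::
  "(complex \<Rightarrow> real) \<Rightarrow> complex set \<Rightarrow> (real \<Rightarrow> complex) \<Rightarrow> (real \<Rightarrow> complex) \<Rightarrow> real set \<Rightarrow> bool" where
  "motion V S z v J \<longleftrightarrow>
     (\<forall>t\<in>J. z t \<in> S \<and>
        (z has_vector_derivative v t) (at t within J) \<and>
        (\<exists>a. GDERIV V (z t) :> a \<and> (v has_vector_derivative a) (at t within J)) \<and>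
        (norm (v t))\<^sup>2 / 2 = V (z t))"

text \<open>All arcs are parametrised by \<open>{0..T}\<close>; the boundary of the disk is \<open>sphere 0 1\<close>.\<close>

definition outer_arc ::
  "real \<Rightarrow> real \<Rightarrow> (real \<Rightarrow> complex) \<Rightarrow> (real \<Rightarrow> complex) \<Rightarrow> real \<Rightarrow> bool" where
  "outer_arc \<omega> \<E> z v T \<longleftrightarrow>
     0 < T \<and> motion (V_E \<omega> \<E>) UNIV z v {0..T} \<and>
     z 0 \<in> sphere 0 1 \<and> z T \<in> sphere 0 1 \<and> (\<forall>t\<in>{0<..<T}. z t \<notin> cball 0 1)"

definition regular_inner_arc ::
  "real \<Rightarrow> real \<Rightarrow> real \<Rightarrow> (real \<Rightarrow> complex) \<Rightarrow> (real \<Rightarrow> complex) \<Rightarrow> real \<Rightarrow> bool" where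
  "regular_inner_arc \<E> h \<mu> z v T \<longleftrightarrow>
     0 < T \<and> motion (V_I \<E> h \<mu>) (- {0}) z v {0..T} \<and>
     z 0 \<in> sphere 0 1 \<and> z T \<in> sphere 0 1 \<and> (\<forall>t\<in>{0<..<T}. z t \<in> ball 0 1)"

text \<open>The radial arc falls into the origin at the time \<open>T / 2\<close> and is continued by time reversal,
  which is what the Levi-Civita regularisation amounts to on collision orbits. The velocity blows
  up at the collision, so \<open>v (T / 2)\<close> is left unspecified.\<close>

definition ejection_collision_arc ::
  "real \<Rightarrow> real \<Rightarrow> real \<Rightarrow> (real \<Rightarrow> complex) \<Rightarrow> (real \<Rightarrow> complex) \<Rightarrow> real \<Rightarrow> bool" where
  "ejection_collision_arc \<E> h \<mu> z v T \<longleftrightarrow>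
     0 < T \<and> motion (V_I \<E> h \<mu>) (- {0}) z v {0..<T/2} \<and>
     z 0 \<in> sphere 0 1 \<and>
     (\<forall>t\<in>{0<..<T/2}. z t \<in> ball 0 1 \<and> z t \<in> closed_segment 0 (z 0)) \<and>
     (z \<longlongrightarrow> 0) (at_left (T/2)) \<and> z (T/2) = 0 \<and>
     (\<forall>t\<in>{0..<T/2}. z (T - t) = z t \<and> v (T - t) = - v t)"

definition inner_arc ::
  "real \<Rightarrow> real \<Rightarrow> real \<Rightarrow> (real \<Rightarrow> complex) \<Rightarrow> (real \<Rightarrow> complex) \<Rightarrow> real \<Rightarrow> bool" where
  "inner_arc \<E> h \<mu> z v T \<longleftrightarrow>
     regular_inner_arc \<E> h \<mu> z v T \<or> ejection_collision_arc \<E> h \<mu> z v T"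

section \<open>Refraction and the first return map\<close>

definition direction :: "complex \<Rightarrow> complex \<Rightarrow> real \<Rightarrow> complex" where
  "direction n t \<alpha> = cos \<alpha> *\<^sub>R n + sin \<alpha> *\<^sub>R t"

text \<open>Snell's law at a point where the potentials on the two sides have the values \<open>V\<close> (incoming
  velocity \<open>v\<close>) and \<open>W\<close> (outgoing velocity \<open>w\<close>); \<open>t\<close> is the unit tangent and \<open>n\<close> the unit normal
  pointing to the side that is entered.\<close>

definition refracts ::
  "real \<Rightarrow> real \<Rightarrow> complex \<Rightarrow> complex \<Rightarrow> complex \<Rightarrow> complex \<Rightarrow> bool" where
  "refracts V W n t v w \<longleftrightarrow>
     (\<exists>\<alpha>\<in>{-pi/2<..<pi/2}. \<exists>\<beta>\<in>{-pi/2<..<pi/2}.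
        v = sqrt (2 * V) *\<^sub>R direction n t \<alpha> \<and>
        w = sqrt (2 * W) *\<^sub>R direction n t \<beta> \<and>
        sqrt V * sin \<alpha> = sqrt W * sin \<beta>)"

definition outgoing_velocity :: "real \<Rightarrow> real \<Rightarrow> complex \<Rightarrow> real \<Rightarrow> complex" where
  "outgoing_velocity \<omega> \<E> p \<alpha> = sqrt (2 * V_E \<omega> \<E> p) *\<^sub>R direction p (\<i> * p) \<alpha>"

text \<open>The first return, as a relation between pairs (polar angle, angle \<open>\<alpha>\<close> with the normal).\<close>

definition first_return ::
  "real \<Rightarrow> real \<Rightarrow> real \<Rightarrow> real \<Rightarrow> angle \<times> real \<Rightarrow> angle \<times> real \<Rightarrow> bool" where
  "first_return \<omega> \<E> h \<mu> = (\<lambda>(\<xi>\<^sub>0, \<alpha>\<^sub>0) (\<xi>\<^sub>1, \<alpha>\<^sub>1).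
     \<alpha>\<^sub>0 \<in> {-pi/2<..<pi/2} \<and> \<alpha>\<^sub>1 \<in> {-pi/2<..<pi/2} \<and>
     (\<exists>x v S y w T p q.
        outer_arc \<omega> \<E> x v S \<and> x 0 = circle_point \<xi>\<^sub>0 \<and>
        v 0 = outgoing_velocity \<omega> \<E> (circle_point \<xi>\<^sub>0) \<alpha>\<^sub>0 \<and> x S = p \<and>
        refracts (V_E \<omega> \<E> p) (V_I \<E> h \<mu> p) (- p) (\<i> * p) (v S) (w 0) \<and>
        inner_arc \<E> h \<mu> y w T \<and> y 0 = p \<and> y T = q \<and> q = circle_point \<xi>\<^sub>1 \<and>
        refracts (V_I \<E> h \<mu> q) (V_E \<omega> \<E> q) q (\<i> * q) (w T) (outgoing_velocity \<omega> \<E> q \<alpha>\<^sub>1)))"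

definition I_c :: "real \<Rightarrow> real \<Rightarrow> real" where
  "I_c \<omega> \<E> = sqrt (\<E> - \<omega>\<^sup>2 / 2)"

definition action_coordinates :: "real \<Rightarrow> real \<Rightarrow> angle \<times> real \<Rightarrow> angle \<times> real" where
  "action_coordinates \<omega> \<E> = (\<lambda>(\<xi>, \<alpha>). (\<xi>, I_c \<omega> \<E> * sin \<alpha>))"

definition first_return_action ::
  "real \<Rightarrow> real \<Rightarrow> real \<Rightarrow> real \<Rightarrow> angle \<times> real \<Rightarrow> angle \<times> real \<Rightarrow> bool" where
  "first_return_action \<omega> \<E> h \<mu> X Y \<longleftrightarrow>
     (\<exists>x\<in>UNIV \<times> {-pi/2<..<pi/2}. \<exists>y\<in>UNIV \<times> {-pi/2<..<pi/2}.
        X = action_coordinates \<omega> \<E> x \<and> Y = action_coordinates \<omega> \<E> y \<and>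
        first_return \<omega> \<E> h \<mu> x y)"

definition first_return_map ::
  "real \<Rightarrow> real \<Rightarrow> real \<Rightarrow> real \<Rightarrow> angle \<times> real \<Rightarrow> angle \<times> real" where
  "first_return_map \<omega> \<E> h \<mu> X = (THE Y. first_return_action \<omega> \<E> h \<mu> X Y)"

section \<open>Action-angle coordinates\<close>

text \<open>Let a surface of section be parametrised by (a lift to \<open>\<real>\<close> of) an angle \<open>\<xi>\<close> and \<open>I \<in> J\<close>,
  the corresponding position and conjugate momentum being \<open>q \<xi> I\<close> and \<open>p \<xi> I\<close>. The coordinates
  are canonical if the symplectic form \<open>dq \<and> dp\<close> restricts to \<open>d\<xi> \<and> dI\<close>, i.e. their Lagrange
  bracket is 1; they are action-angle coordinates of the map \<open>F\<close> if, moreover, \<open>F\<close> preserves \<open>I\<close>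
  and rotates \<open>\<xi>\<close> by an amount that depends on \<open>I\<close> only.\<close>

definition canonical_coordinates ::
  "(real \<Rightarrow> real \<Rightarrow> complex) \<Rightarrow> (real \<Rightarrow> real \<Rightarrow> complex) \<Rightarrow> real set \<Rightarrow> bool" where
  "canonical_coordinates q p J \<longleftrightarrow>
     (\<forall>\<xi>. \<forall>I\<in>J. \<exists>q\<^sub>\<xi> q\<^sub>I p\<^sub>\<xi> p\<^sub>I.
        ((\<lambda>x. q x I) has_vector_derivative q\<^sub>\<xi>) (at \<xi>) \<and>
        ((\<lambda>x. q \<xi> x) has_vector_derivative q\<^sub>I) (at I) \<and>
        ((\<lambda>x. p x I) has_vector_derivative p\<^sub>\<xi>) (at \<xi>) \<and>
        ((\<lambda>x. p \<xi> x) has_vector_derivative p\<^sub>I) (at I) \<and>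
        inner q\<^sub>\<xi> p\<^sub>I - inner q\<^sub>I p\<^sub>\<xi> = 1)"

definition action_angle_coordinates ::
  "(real \<Rightarrow> real \<Rightarrow> complex) \<Rightarrow> (real \<Rightarrow> real \<Rightarrow> complex) \<Rightarrow> real set \<Rightarrow>
   (angle \<times> real \<Rightarrow> angle \<times> real) \<Rightarrow> bool" where
  "action_angle_coordinates q p J F \<longleftrightarrow>
     canonical_coordinates q p J \<and>
     (\<exists>\<rho>. \<forall>\<xi>. \<forall>I\<in>J. F (abs_angle \<xi>, I) = (abs_angle (\<xi> + \<rho> I), I))"

definition boundary_position :: "real \<Rightarrow> real \<Rightarrow> complex" where
  "boundary_position \<xi> I = cis \<xi>"

text \<open>The momentum conjugate to the position for the Jacobi length \<open>\<integral> sqrt (V_E z) * \<bar>z'\<bar>\<close>, whose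
  geodesics are the outer arcs: \<open>sqrt V_E\<close> times the unit velocity, here at the boundary point of
  angle \<open>\<xi>\<close> in the outward direction of action \<open>I\<close>.\<close>

definition jacobi_momentum :: "real \<Rightarrow> real \<Rightarrow> real \<Rightarrow> real \<Rightarrow> complex" where
  "jacobi_momentum \<omega> \<E> \<xi> I =
     sqrt (V_E \<omega> \<E> (cis \<xi>)) *\<^sub>R direction (cis \<xi>) (\<i> * cis \<xi>) (arcsin (I / I_c \<omega> \<E>))"

section \<open>The rotation angle\<close>

definition f_shift :: "real \<Rightarrow> real \<Rightarrow> real \<Rightarrow> real" where
  "f_shift \<omega> \<E> I =
     (if I = 0 then 0
      else if I > 0 then
        arccot ((\<E> - 2 * I\<^sup>2) / (I * sqrt (4 * \<E> - 2 * (2 * I\<^sup>2 + \<omega>\<^sup>2))))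
      else
        arccot ((\<E> - 2 * I\<^sup>2) / (I * sqrt (4 * \<E> - 2 * (2 * I\<^sup>2 + \<omega>\<^sup>2)))) - pi)"

definition g_shift :: "real \<Rightarrow> real \<Rightarrow> real \<Rightarrow> real \<Rightarrow> real" where
  "g_shift \<E> h \<mu> I =
     (if I = 0 then 0
      else if I > 0 then
        2 * arccos ((2 * I\<^sup>2 - \<mu>) / sqrt (4 * (\<E> + h) * I\<^sup>2 + \<mu>\<^sup>2)) - 2 * pi
      else
        - 2 * arccos ((2 * I\<^sup>2 - \<mu>) / sqrt (4 * (\<E> + h) * I\<^sup>2 + \<mu>\<^sup>2)) + 2 * pi)"

definition theta_bar :: "real \<Rightarrow> real \<Rightarrow> real \<Rightarrow> real \<Rightarrow> real \<Rightarrow> real" where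
  "theta_bar \<omega> \<E> h \<mu> I = f_shift \<omega> \<E> I + g_shift \<E> h \<mu> I"

end

theory Submission
  imports Defs "HOL-Complex_Analysis.Cauchy_Integral_Formula"
begin

text \<open>The map is a definite description over a relation, so two things are needed of each arc:
  every arc with the given initial data ends where claimed, and at least one such arc exists. The
  obstacle is I = 0: there the inner arc runs into the singularity of the potential, and f and g
  change branch. Both difficulties vanish once a rotation is written as a unit complex number. With
  P the normal speed and L the angular momentum on the side concerned, the outer arc turns by the
  argument of (omega^2 + P^2 - L^2) + 2iPL, the inner arc by twice the argument of (L^2 - mu) + iLP.
  Inserting the energy P^2 + L^2 = 2V on the circle turns these numbers into 2 *
  \<open>bend_number\<close> and - cnj \<open>bend_number\<close>; doubling the second argument
  makes its minus sign harmless and produces the factor -2 of g. As for the bound 10: the derivative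
  of each rotation angle is a quadratic in I over another quadratic times a square root, so
  cross-multiplying and squaring gives degree 4 * 2 + 2.\<close>

text \<open>Angular momentum \<open>L = sqrt 2 * I\<close> is preserved along both kinds of arcs and by Snell's law, so
  \<open>I\<close> is an integral and only the rotation angle of each arc has to be found. Outer arcs are explicit
  harmonic motions. The end point of an inner arc is forced by conservation of the
  Laplace--Runge--Lenz vector, and existence comes from the parametrisation of Kepler hyperbolas by
  the eccentric anomaly, which also covers the collision orbits. Both rotation angles are multiples of
  arguments of explicit complex numbers; hence they are analytic, and the zeros of the derivative of
  their sum are roots of a polynomial of degree at most 10 in \<open>I\<close>.\<close>

section \<open>Analyticity and critical points of the rotation angle\<close>

text \<open>Both halves of the return map rotate the circle by a multiple of the argument of this number:
  the outer arc by \<open>bend \<E> (\<E> - \<omega>\<^sup>2 / 2) I\<close> and the inner arc by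
  \<open>- 2 * bend \<mu> (\<E> + h + \<mu>) I\<close>. It stays off the negative real axis, so the three-part
  formulas of \<open>f_shift\<close> and \<open>g_shift\<close> glue analytically at \<open>I = 0\<close>.\<close>

definition bend_number :: "real \<Rightarrow> real \<Rightarrow> real \<Rightarrow> complex" where
  "bend_number a s x = Complex (a - 2 * x\<^sup>2) (2 * x * sqrt (s - x\<^sup>2))"

definition bend :: "real \<Rightarrow> real \<Rightarrow> real \<Rightarrow> real" where
  "bend a s x = Arg (bend_number a s x)"

text \<open>The imaginary part vanishes only at \<open>x = 0\<close>, and there the real part is
  \<open>a > 0\<close>.\<close>

lemma bend_number_notin_nonpos_Reals:
  assumes "0 < a" "x\<^sup>2 < s"
  shows "bend_number a s x \<notin> \<real>\<^sub>\<le>\<^sub>0"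
  using assms by (auto simp: complex_nonpos_Reals_iff bend_number_def)

lemma bend_number_nonzero: "0 < a \<Longrightarrow> x\<^sup>2 < s \<Longrightarrow> bend_number a s x \<noteq> 0"
  using bend_number_notin_nonpos_Reals by fastforce

lemma norm_bend_number_sq:
  assumes "x\<^sup>2 \<le> s"
  shows "(norm (bend_number a s x))\<^sup>2 = a\<^sup>2 + 4 * (s - a) * x\<^sup>2"
  using assms unfolding bend_number_def cmod_power2
  by (simp add: power_mult_distrib) (simp add: power2_eq_square algebra_simps)

lemma cis_bend:
  "0 < a \<Longrightarrow> x\<^sup>2 < s \<Longrightarrow> cis (bend a s x) = sgn (bend_number a s x)"
  unfolding bend_def using cis_Arg bend_number_nonzero by blast

text \<open>Near \<open>x\<close> the argument is the imaginary part of \<open>Ln\<close>, so its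
  derivative is Im (z' / z) = (X Y' - X' Y) / (X^2 + Y^2) for z = X + iY. Only a single square root
  survives, which is what allows the later reduction to a polynomial.\<close>

lemma bend_has_real_derivative:
  assumes a: "0 < a" and x: "x\<^sup>2 < s"
  shows "(bend a s has_real_derivative
    (2 * a * s - 4 * (a - s) * x\<^sup>2) / ((a\<^sup>2 + 4 * (s - a) * x\<^sup>2) * sqrt (s - x\<^sup>2))) (at x)"
proof -
  define q where "q = sqrt (s - x\<^sup>2)"
  have q: "q > 0" "q\<^sup>2 = s - x\<^sup>2" using x by (auto simp: q_def)
  define X Y where "X = a - 2 * x\<^sup>2" and "Y = 2 * x * q"
  define Y' where "Y' = 2 * q - 2 * x\<^sup>2 / q"
  let ?N = "a\<^sup>2 + 4 * (s - a) * x\<^sup>2"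
  have N: "X\<^sup>2 + Y\<^sup>2 = ?N"
    using norm_bend_number_sq[of x s a] x by (simp add: bend_number_def cmod_power2 X_def Y_def q_def)
  have z: "bend_number a s x = Complex X Y" by (simp add: bend_number_def X_def Y_def q_def)
  have "(bend_number a s has_vector_derivative Complex (- 4 * x) Y') (at x)"
    unfolding has_vector_derivative_complex_iff bend_number_def complex.sel Y'_def q_def
    using x by (auto intro!: derivative_eq_intros simp: divide_simps power2_eq_square)
  then have L: "((\<lambda>y. Ln (bend_number a s y)) has_vector_derivative
      Complex (- 4 * x) Y' * inverse (bend_number a s x)) (at x)"
    using field_vector_diff_chain_at[of "bend_number a s" _ x Ln "inverse (bend_number a s x)"]
      has_field_derivative_Ln[OF bend_number_notin_nonpos_Reals[OF a x]]
    by (auto simp: o_def)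
  then have D: "((\<lambda>y. Im (Ln (bend_number a s y))) has_real_derivative
      Im (Complex (- 4 * x) Y' * inverse (bend_number a s x))) (at x)"
    unfolding has_vector_derivative_complex_iff by simp
  have s: "s = q\<^sup>2 + x\<^sup>2" using q(2) by simp
  have "X * Y' + 4 * x * Y = (2 * a * s - 4 * (a - s) * x\<^sup>2) / q"
    unfolding X_def Y_def Y'_def s using q(1)
    by (simp add: field_simps) (simp add: algebra_simps power2_eq_square)
  moreover have "Im (Complex (- 4 * x) Y' * inverse (Complex X Y)) = (X * Y' + 4 * x * Y) / (X\<^sup>2 + Y\<^sup>2)"
    by (simp add: add_divide_distrib diff_divide_distrib mult_ac)
  ultimately have "Im (Complex (- 4 * x) Y' * inverse (bend_number a s x)) =
      (2 * a * s - 4 * (a - s) * x\<^sup>2) / (?N * q)"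
    unfolding z N by (simp add: mult.commute)
  with D have D': "((\<lambda>y. Im (Ln (bend_number a s y))) has_real_derivative
      (2 * a * s - 4 * (a - s) * x\<^sup>2) / (?N * q)) (at x)" by simp
  have "\<forall>\<^sub>F y in nhds x. y \<in> {y. y\<^sup>2 < s}"
    using x by (intro eventually_nhds_in_open open_Collect_less continuous_intros) auto
  then have ev: "\<forall>\<^sub>F y in nhds x. bend a s y = Im (Ln (bend_number a s y))"
    by eventually_elim (auto simp: bend_def Arg_eq_Im_Ln bend_number_nonzero[OF a])
  then show ?thesis
    using D' DERIV_cong_ev[OF refl ev refl] by (simp add: q_def)
qed

text \<open>The powers \<open>(y - x) ^ n\<close> are real on the real line, so the imaginary parts
  of the complex Taylor coefficients are the coefficients of a real power series.\<close>

lemma real_analytic_at_Im: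
  assumes "F analytic_on {complex_of_real x}"
    and "\<forall>\<^sub>F y in nhds x. f y = Im (F (complex_of_real y))"
  shows "\<exists>r>0. \<exists>a. \<forall>y. \<bar>y - x\<bar> < r \<longrightarrow> (\<lambda>n. a n * (y - x) ^ n) sums f y"
proof -
  obtain r1 where r1: "r1 > 0" "F holomorphic_on ball (complex_of_real x) r1"
    using assms(1) by (auto simp: analytic_at_ball)
  obtain r2 where r2: "r2 > 0" "\<And>y. dist y x < r2 \<Longrightarrow> f y = Im (F (complex_of_real y))"
    using assms(2) by (auto simp: eventually_nhds_metric)
  define b where "b n = (deriv ^^ n) F (complex_of_real x) / fact n" for n
  have "(\<lambda>n. Im (b n) * (y - x) ^ n) sums f y" if y: "\<bar>y - x\<bar> < min r1 r2" for y
  proof -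
    have "complex_of_real y \<in> ball (complex_of_real x) r1"
      using y by (simp add: dist_real_def abs_minus_commute)
    from holomorphic_power_series[OF r1(2) this]
    have "(\<lambda>n. b n * of_real ((y - x) ^ n)) sums F (complex_of_real y)"
      by (simp add: b_def)
    from sums_Im[OF this] show ?thesis
      using y r2(2) by (simp add: dist_real_def)
  qed
  with r1(1) r2(1) show ?thesis
    by (intro exI[of _ "min r1 r2"] conjI exI[of _ "\<lambda>n. Im (b n)"]) auto
qed

lemma bend_real_analytic:
  assumes a: "0 < a" and f: "\<And>x. x \<in> S \<Longrightarrow> f x = c * bend a s x"
    and S: "open S" "\<And>x. x \<in> S \<Longrightarrow> x\<^sup>2 < s"
  shows "real_analytic_on f S"
  unfolding real_analytic_on_def
proof
  fix x assume x: "x \<in> S"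
  \<comment> \<open>The extension of \<open>bend_number\<close> to complex arguments. At
    \<open>x\<close> both \<open>csqrt\<close> and \<open>Ln\<close> are evaluated off their branch
    cut.\<close>
  let ?G = "\<lambda>w. (of_real a - 2 * w\<^sup>2) + 2 * \<i> * w * csqrt (of_real s - w\<^sup>2)"
  let ?F = "\<lambda>w. of_real c * Ln (?G w)"
  have G: "?G (of_real y) = bend_number a s y" if "y\<^sup>2 < s" for y
  proof -
    have "csqrt (of_real s - (of_real y)\<^sup>2) = of_real (sqrt (s - y\<^sup>2))"
      using that of_real_sqrt[of "s - y\<^sup>2"] by simp
    then show ?thesis by (simp add: bend_number_def complex_eq_iff flip: of_real_power)
  qed
  have "of_real s - (complex_of_real x)\<^sup>2 \<notin> \<real>\<^sub>\<le>\<^sub>0"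
    using S(2)[OF x] by (simp add: complex_nonpos_Reals_iff flip: of_real_power of_real_diff)
  then have "?G analytic_on {complex_of_real x}" by (intro analytic_intros) auto
  moreover have "?G (complex_of_real x) \<notin> \<real>\<^sub>\<le>\<^sub>0"
    using G[OF S(2)[OF x]] bend_number_notin_nonpos_Reals[OF a S(2)[OF x]] by simp
  ultimately have "(\<lambda>w. Ln (?G w)) analytic_on {complex_of_real x}"
    using analytic_on_compose_gen[of ?G "{complex_of_real x}" Ln "- \<real>\<^sub>\<le>\<^sub>0"]
    by (auto simp: o_def intro: analytic_intros)
  then have A: "?F analytic_on {complex_of_real x}" by (intro analytic_on_mult analytic_on_const)
  have "\<forall>\<^sub>F y in nhds x. y \<in> S" using S(1) x by (rule eventually_nhds_in_open)
  then have "\<forall>\<^sub>F y in nhds x. f y = Im (?F (complex_of_real y))"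
    by eventually_elim (simp add: f G S(2) bend_def Arg_eq_Im_Ln bend_number_nonzero[OF a])
  then show "\<exists>r>0. \<exists>a. \<forall>y. \<bar>y - x\<bar> < r \<longrightarrow> (\<lambda>n. a n * (y - x) ^ n) sums f y"
    by (rule real_analytic_at_Im[OF A])
qed

section \<open>The branches of arccot and arccos in the two shift functions\<close>

lemma arccot_eqI:
  assumes "0 < y" "y < pi" "cot y = x"
  shows "arccot x = y"
  unfolding arccot_def
proof (rule the_equality)
  fix z assume z: "0 < z \<and> z < pi \<and> cot z = x"
  then have "sin z > 0" "sin y > 0" using assms by (auto intro: sin_gt_zero)
  then have "sin (z - y) = 0"
    using z assms by (simp add: cot_def sin_diff field_simps)
  moreover have "\<bar>z - y\<bar> < pi" using z assms by auto
  ultimately show "z = y" 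
    by (metis abs_of_pos eq_iff_diff_eq_0 linorder_neqE_linordered_idom sin_gt_zero sin_minus
        abs_minus_cancel neg_0_less_iff_less less_numeral_extra(3) neg_equal_0_iff_equal)
qed (use assms in auto)

lemma
  fixes x :: real
  assumes a: "0 < a" and x: "x\<^sup>2 < s" "x \<noteq> 0"
  shows bend_pos: "0 < x \<Longrightarrow> 0 < bend a s x \<and> bend a s x < pi"
    and bend_neg: "x < 0 \<Longrightarrow> - pi < bend a s x \<and> bend a s x < 0"
    and cos_bend: "cos (bend a s x) = (a - 2 * x\<^sup>2) / sqrt (a\<^sup>2 + 4 * (s - a) * x\<^sup>2)"
    and cot_bend: "cot (bend a s x) = (a - 2 * x\<^sup>2) / (2 * x * sqrt (s - x\<^sup>2))"
proof -
  let ?z = "bend_number a s x"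
  have Im: "Im ?z = 2 * x * sqrt (s - x\<^sup>2)" "Re ?z = a - 2 * x\<^sup>2" by (auto simp: bend_number_def)
  have n: "norm ?z = sqrt (a\<^sup>2 + 4 * (s - a) * x\<^sup>2)"
    using norm_bend_number_sq[of x s a] x by (metis less_imp_le norm_ge_zero real_sqrt_unique)
  have z: "?z \<noteq> 0" using bend_number_nonzero a x by blast
  show "0 < bend a s x \<and> bend a s x < pi" if "0 < x"
    unfolding bend_def Arg_lt_pi Im using that x by simp
  show "- pi < bend a s x \<and> bend a s x < 0" if "x < 0"
    unfolding bend_def Arg_neg_iff Im using that x Arg_bounded[of ?z] by (simp add: mult_neg_pos)
  have "cis (bend a s x) = sgn ?z" using cis_bend a x by blast
  then have c: "cos (bend a s x) = Re ?z / norm ?z" "sin (bend a s x) = Im ?z / norm ?z"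
    by (auto simp: complex_eq_iff)
  show "cos (bend a s x) = (a - 2 * x\<^sup>2) / sqrt (a\<^sup>2 + 4 * (s - a) * x\<^sup>2)"
    unfolding c Im n ..
  show "cot (bend a s x) = (a - 2 * x\<^sup>2) / (2 * x * sqrt (s - x\<^sup>2))"
    unfolding cot_def c Im using z by simp
qed

lemma bend_0: "0 < a \<Longrightarrow> bend a s 0 = 0"
  by (simp add: bend_def bend_number_def Arg_eq_0 complex_is_Real_iff)

text \<open>Both sides have the same cotangent, which has period pi. For \<open>x < 0\<close> the
  bend lies in (-pi, 0) while \<open>arccot\<close> selects the value in (0, pi); the term - pi in
  the third case undoes exactly this shift.\<close>

lemma f_shift_eq_bend:
  assumes "0 < \<E>" "x\<^sup>2 < \<E> - \<omega>\<^sup>2 / 2"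
  shows "f_shift \<omega> \<E> x = bend \<E> (\<E> - \<omega>\<^sup>2 / 2) x"
proof (cases "x = 0")
  case False
  let ?b = "bend \<E> (\<E> - \<omega>\<^sup>2 / 2) x"
  have "4 * \<E> - 2 * (2 * x\<^sup>2 + \<omega>\<^sup>2) = 2\<^sup>2 * (\<E> - \<omega>\<^sup>2 / 2 - x\<^sup>2)" by (simp add: algebra_simps)
  then have "sqrt (4 * \<E> - 2 * (2 * x\<^sup>2 + \<omega>\<^sup>2)) = 2 * sqrt (\<E> - \<omega>\<^sup>2 / 2 - x\<^sup>2)"
    by (simp only: real_sqrt_mult real_sqrt_abs)
  then have c: "cot ?b = (\<E> - 2 * x\<^sup>2) / (x * sqrt (4 * \<E> - 2 * (2 * x\<^sup>2 + \<omega>\<^sup>2)))"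
    using cot_bend[OF assms False] by (simp add: mult_ac)
  show ?thesis
  proof (cases "x > 0")
    case True
    then show ?thesis
      using bend_pos[OF assms False True] c arccot_eqI by (simp add: f_shift_def)
  next
    case neg: False
    have "cot (?b + pi) = cot ?b" by (simp add: cot_def)
    then have "arccot (cot ?b) = ?b + pi"
      using bend_neg[OF assms False] neg False by (intro arccot_eqI) auto
    then show ?thesis
      using neg False c by (simp add: f_shift_def)
  qed
qed (use assms in \<open>simp add: f_shift_def bend_0\<close>)

text \<open>The argument of \<open>arccos\<close> is minus the cosine of the bend b, so for
  \<open>x > 0\<close> the value is pi - b, and 2 (pi - b) - 2 pi = -2 b. For \<open>x < 0\<close>
  the same works with -b, which is then the value in (0, pi).\<close>

lemma g_shift_eq_bend:
  assumes "0 < \<mu>" "x\<^sup>2 < \<E> + h + \<mu>"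
  shows "g_shift \<E> h \<mu> x = - 2 * bend \<mu> (\<E> + h + \<mu>) x"
proof (cases "x = 0")
  case False
  let ?b = "bend \<mu> (\<E> + h + \<mu>) x"
  have "(2 * x\<^sup>2 - \<mu>) / sqrt (4 * (\<E> + h) * x\<^sup>2 + \<mu>\<^sup>2) = - cos ?b"
    using cos_bend[OF assms False]
    by (simp add: add.commute[of "\<mu>\<^sup>2"] minus_divide_left)
  then have e: "arccos ((2 * x\<^sup>2 - \<mu>) / sqrt (4 * (\<E> + h) * x\<^sup>2 + \<mu>\<^sup>2)) = arccos (- cos ?b)" by simp
  show ?thesis
  proof (cases "x > 0")
    case True
    then have "arccos (- cos ?b) = pi - ?b"
      using bend_pos[OF assms False True] by (simp add: arccos_minus arccos_cos)
    then show ?thesis using e True by (simp add: g_shift_def)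
  next
    case neg: False
    then have b: "- pi < ?b" "?b < 0" using bend_neg[OF assms False] False by auto
    then have "arccos (cos (- ?b)) = - ?b" by (intro arccos_cos) auto
    then have "arccos (- cos ?b) = pi + ?b" by (simp add: arccos_minus)
    then show ?thesis using e neg False by (simp add: g_shift_def)
  qed
qed (use assms in \<open>simp add: g_shift_def bend_0\<close>)

text \<open>Clearing denominators in \<open>D x = 0\<close> and squaring once more gives a polynomial equation of
  degree at most 10 in \<open>x\<close>; the polynomial is nonzero because only one of its two terms survives
  at \<open>x\<^sup>2 = m\<close>.\<close>

lemma card_critical_points_le:
  fixes a b m n :: real
  assumes "0 < a" "0 < b" "a < 2 * m" "m < n" "b \<le> n"
  defines "D \<equiv> \<lambda>x. (2 * a * m - 4 * (a - m) * x\<^sup>2) / ((a\<^sup>2 + 4 * (m - a) * x\<^sup>2) * sqrt (m - x\<^sup>2))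
    - 2 * ((2 * b * n - 4 * (b - n) * x\<^sup>2) / ((b\<^sup>2 + 4 * (n - b) * x\<^sup>2) * sqrt (n - x\<^sup>2)))"
  shows "finite {x. x\<^sup>2 < m \<and> D x = 0}" "card {x. x\<^sup>2 < m \<and> D x = 0} \<le> 10"
proof -
  define A B A' B' :: "real poly" where "A = [:2 * a * m, 0, - 4 * (a - m):]"
    and "B = [:2 * b * n, 0, - 4 * (b - n):]"
    and "A' = [:a\<^sup>2, 0, 4 * (m - a):]" and "B' = [:b\<^sup>2, 0, 4 * (n - b):]"
  define Q where "Q = (A * B')\<^sup>2 * [:n, 0, - 1:] - smult 4 ((B * A')\<^sup>2 * [:m, 0, - 1:])"
  have poly: "poly A x = 2 * a * m - 4 * (a - m) * x\<^sup>2" "poly B x = 2 * b * n - 4 * (b - n) * x\<^sup>2"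
    "poly A' x = a\<^sup>2 + 4 * (m - a) * x\<^sup>2" "poly B' x = b\<^sup>2 + 4 * (n - b) * x\<^sup>2" for x
    by (simp_all add: A_def B_def A'_def B'_def power2_eq_square algebra_simps)
  have Q: "poly Q x = (poly A x * poly B' x)\<^sup>2 * (n - x\<^sup>2) - 4 * (poly B x * poly A' x)\<^sup>2 * (m - x\<^sup>2)" for x
    unfolding Q_def by (simp add: power2_eq_square algebra_simps)
  have deg: "degree A \<le> 2" "degree B \<le> 2" "degree A' \<le> 2" "degree B' \<le> 2"
    "degree [:n, 0, - 1:] \<le> 2" "degree [:m, 0, - 1:] \<le> 2"
    by (auto simp: A_def B_def A'_def B'_def)
  have d1: "degree ((p * q)\<^sup>2 * r) \<le> 10" if "degree p \<le> 2" "degree q \<le> 2" "degree r \<le> 2"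
    for p q r :: "real poly"
  proof -
    have "degree (p * q) \<le> 4" using degree_mult_le[of p q] that by linarith
    then have "degree ((p * q)\<^sup>2) \<le> 8" using degree_power_le[of "p * q" 2] by linarith
    then show ?thesis using degree_mult_le[of "(p * q)\<^sup>2" r] that by linarith
  qed
  have degQ: "degree Q \<le> 10"
    unfolding Q_def by (intro degree_diff_le order_trans[OF degree_smult_le d1] d1 deg)
  \<comment> \<open>At \<open>x = sqrt m\<close> the subtracted term of \<open>Q\<close> is zero;
    the other one is not, because \<open>a < 2 * m\<close> and \<open>m < n\<close>.\<close>
  have "m > 0" using assms by linarith
  then have "poly A (sqrt m) = 2 * m * (2 * m - a)" "poly B' (sqrt m) = b\<^sup>2 + 4 * (n - b) * m"
    unfolding poly by (simp_all add: algebra_simps)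
  moreover have "2 * m * (2 * m - a) > 0" "b\<^sup>2 + 4 * (n - b) * m > 0"
    using \<open>m > 0\<close> assms by (auto intro: add_pos_nonneg)
  ultimately have "poly A (sqrt m) * poly B' (sqrt m) \<noteq> 0" by auto
  then have "poly Q (sqrt m) > 0"
    unfolding Q using \<open>m > 0\<close> assms(4) by simp
  then have "Q \<noteq> 0" by auto
  have "poly Q x = 0" if x: "x\<^sup>2 < m" "D x = 0" for x
  proof -
    have "x\<^sup>2 < n" using x assms(4) by linarith
    have "b\<^sup>2 + 4 * (n - b) * x\<^sup>2 > 0" using assms by (auto intro: add_pos_nonneg)
    then have B': "poly B' x > 0" by (simp add: poly)
    have A': "poly A' x > 0"
    proof (cases "m \<ge> a")
      case True
      then show ?thesis unfolding poly using assms by (auto intro: add_pos_nonneg)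
    next
      \<comment> \<open>The polynomial \<open>A'\<close> now decreases in \<open>x\<^sup>2\<close>,
        so for \<open>x\<^sup>2 < m\<close> it is at least its value at
        \<open>x\<^sup>2 = m\<close>, which is the square
        \<open>(a - 2 * m)\<^sup>2\<close>.\<close>
      case False
      then have "4 * (a - m) * x\<^sup>2 \<le> 4 * (a - m) * m" using x by (intro mult_left_mono) auto
      moreover have "0 < (a - 2 * m)\<^sup>2" using assms by simp
      then have "4 * (a - m) * m < a\<^sup>2" by (simp add: power2_eq_square algebra_simps)
      ultimately show ?thesis unfolding poly by (simp add: algebra_simps)
    qed
    have s: "sqrt (m - x\<^sup>2) > 0" "sqrt (n - x\<^sup>2) > 0" using x \<open>x\<^sup>2 < n\<close> by auto
    have "poly A x / (poly A' x * sqrt (m - x\<^sup>2)) = 2 * (poly B x / (poly B' x * sqrt (n - x\<^sup>2)))"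
      using x(2) by (simp add: D_def poly)
    then have "poly A x * poly B' x * sqrt (n - x\<^sup>2) = 2 * (poly B x * poly A' x) * sqrt (m - x\<^sup>2)"
      using A' B' s by (simp add: field_simps)
    then have "(poly A x * poly B' x * sqrt (n - x\<^sup>2))\<^sup>2 = (2 * (poly B x * poly A' x) * sqrt (m - x\<^sup>2))\<^sup>2"
      by simp
    then show ?thesis
      using x \<open>x\<^sup>2 < n\<close> unfolding Q by (simp add: power_mult_distrib)
  qed
  then have sub: "{x. x\<^sup>2 < m \<and> D x = 0} \<subseteq> {x. poly Q x = 0}" by auto
  have fin: "finite {x. poly Q x = 0}" using poly_roots_finite[OF \<open>Q \<noteq> 0\<close>] .
  show "finite {x. x\<^sup>2 < m \<and> D x = 0}" using finite_subset[OF sub fin] .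
  show "card {x. x\<^sup>2 < m \<and> D x = 0} \<le> 10"
    using card_mono[OF fin sub] card_poly_roots_bound[OF \<open>Q \<noteq> 0\<close>] degQ by linarith
qed

section \<open>Outer arcs\<close>

text \<open>\<open>motion\<close> only asserts that some gradient exists; uniqueness identifies it
  with the explicit gradients of the two potentials.\<close>

lemma GDERIV_unique:
  assumes "GDERIV f x :> a" "GDERIV f x :> b"
  shows "a = b"
proof -
  have "(\<lambda>h. inner h a) = (\<lambda>h. inner h b)"
    using has_derivative_unique assms unfolding gderiv_def by blast
  then have "inner (a - b) a = inner (a - b) b" by metis
  then show ?thesis by (metis inner_diff_right inner_eq_zero_iff right_minus_eq)
qed

lemma GDERIV_V_E: "GDERIV (V_E \<omega> \<E>) z :> (- \<omega>\<^sup>2) *\<^sub>R z"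
  unfolding V_E_def [abs_def] gderiv_def power2_norm_eq_inner
  by (auto intro!: derivative_eq_intros simp: inner_commute)

lemma motion_has_vector_derivative:
  assumes "motion V S z v J" "t \<in> J"
  shows "(z has_vector_derivative v t) (at t within J)"
    and "GDERIV V (z t) :> a \<Longrightarrow> (v has_vector_derivative a) (at t within J)"
proof -
  obtain b where "GDERIV V (z t) :> b" "(v has_vector_derivative b) (at t within J)"
    using assms unfolding motion_def by blast
  then show "GDERIV V (z t) :> a \<Longrightarrow> (v has_vector_derivative a) (at t within J)"
    using GDERIV_unique by metis
qed (use assms in \<open>auto simp: motion_def\<close>)

lemma eq_at_0_if_derivative_0:
  assumes "\<And>t. t \<in> {0..T} \<Longrightarrow> (f has_vector_derivative 0) (at t within {0..T})" "t \<in> {0..T}"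
  shows "f t = f (0::real)"
proof -
  obtain c where "\<And>s. s \<in> {0..T} \<Longrightarrow> f s = c"
    using has_vector_derivative_zero_constant[of "{0..T}" f] assms(1) by auto
  with assms(2) show ?thesis by simp
qed

text \<open>The position and velocity at time \<open>t\<close> of the harmonic motion that starts at \<open>1\<close> with
  velocity \<open>c\<close>. A velocity at a point \<open>p\<close> of the unit circle is always written
  \<open>p * Complex P L\<close>: its radial component is \<open>P\<close> and its angular momentum \<open>L\<close>.\<close>

definition osc :: "real \<Rightarrow> complex \<Rightarrow> real \<Rightarrow> complex" where
  "osc \<omega> c t = of_real (cos (\<omega> * t)) + of_real (sin (\<omega> * t) / \<omega>) * c"

definition osc_velocity :: "real \<Rightarrow> complex \<Rightarrow> real \<Rightarrow> complex" where
  "osc_velocity \<omega> c t = of_real (- \<omega> * sin (\<omega> * t)) + of_real (cos (\<omega> * t)) * c"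

lemma osc_has_vector_derivative:
  assumes "\<omega> \<noteq> 0"
  shows "(osc \<omega> c has_vector_derivative osc_velocity \<omega> c t) (at t within J)"
    and "(osc_velocity \<omega> c has_vector_derivative (- \<omega>\<^sup>2) *\<^sub>R osc \<omega> c t) (at t within J)"
  unfolding has_vector_derivative_complex_iff osc_def [abs_def] osc_velocity_def [abs_def] using assms
  by (auto intro!: derivative_eq_intros simp: field_simps power2_eq_square)

text \<open>Transporting position and velocity back to time 0 by the inverse of the harmonic flow
  gives two constants of motion, namely the initial data. Applying the flow again recovers the
  orbit, which proves uniqueness by hand.\<close>

lemma motion_V_E_eq_osc:
  assumes m: "motion (V_E \<omega> \<E>) UNIV z v {0..T}" and \<omega>: "\<omega> \<noteq> 0"
    and v0: "v 0 = z 0 * c" and t: "t \<in> {0..T}"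
  shows "z t = z 0 * osc \<omega> c t" "v t = z 0 * osc_velocity \<omega> c t"
proof -
  define C S where "C s = complex_of_real (cos (\<omega> * s))" and "S s = complex_of_real (sin (\<omega> * s))" for s
  have dC: "(C has_vector_derivative - of_real \<omega> * S s) (at s within J)"
   and dS: "(S has_vector_derivative of_real \<omega> * C s) (at s within J)" for s J
    unfolding has_vector_derivative_complex_iff C_def S_def
    by (auto intro!: derivative_eq_intros)
  have dz: "(z has_vector_derivative v s) (at s within {0..T})"
    and dv: "(v has_vector_derivative - (of_real \<omega>)\<^sup>2 * z s) (at s within {0..T})" if "s \<in> {0..T}" for s
    using motion_has_vector_derivative[OF m that] GDERIV_V_E[of \<omega> \<E> "z s"]
    by (auto simp: scaleR_conv_of_real)
  have 1: "C t * z t - S t / of_real \<omega> * v t = C 0 * z 0 - S 0 / of_real \<omega> * v 0"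
    by (rule eq_at_0_if_derivative_0[OF _ t])
      (use \<omega> in \<open>auto intro!: derivative_eq_intros dC dS dz dv simp: field_simps power2_eq_square\<close>)
  have 2: "of_real \<omega> * S t * z t + C t * v t = of_real \<omega> * S 0 * z 0 + C 0 * v 0"
    by (rule eq_at_0_if_derivative_0[OF _ t])
      (use \<omega> in \<open>auto intro!: derivative_eq_intros dC dS dz dv simp: field_simps power2_eq_square\<close>)
  have cs: "C t * C t + S t * S t = 1"
    unfolding C_def S_def
    by (metis of_real_1 of_real_add of_real_mult power2_eq_square sin_cos_squared_add3)
  have z0: "C 0 * z 0 - S 0 / of_real \<omega> * v 0 = z 0" "of_real \<omega> * S 0 * z 0 + C 0 * v 0 = z 0 * c"
    by (simp_all add: C_def S_def v0)
  have "z t = (C t * C t + S t * S t) * z t" by (simp add: cs)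
  also have "\<dots> = C t * (C t * z t - S t / of_real \<omega> * v t) + S t / of_real \<omega> * (of_real \<omega> * S t * z t + C t * v t)"
    using \<omega> by (simp add: algebra_simps)
  finally show "z t = z 0 * osc \<omega> c t"
    unfolding 1 2 z0 by (simp add: osc_def C_def S_def algebra_simps)
  have "v t = (C t * C t + S t * S t) * v t" by (simp add: cs)
  also have "\<dots> = - of_real \<omega> * S t * (C t * z t - S t / of_real \<omega> * v t) + C t * (of_real \<omega> * S t * z t + C t * v t)"
    using \<omega> by (simp add: algebra_simps)
  finally show "v t = z 0 * osc_velocity \<omega> c t"
    unfolding 1 2 z0 by (simp add: osc_velocity_def C_def S_def algebra_simps)
qed

text \<open>Along the orbit \<open>\<bar>z\<bar>\<^sup>2 - 1\<close> is \<open>K * sin (\<omega> * t) * sin (\<phi> - \<omega> * t)\<close> with \<open>K\<close> and \<open>\<phi>\<close> the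
  modulus and argument of this number, so the return time is \<open>\<phi> / \<omega>\<close>.\<close>

definition osc_phase :: "real \<Rightarrow> real \<Rightarrow> real \<Rightarrow> complex" where
  "osc_phase \<omega> P L = Complex (1 - (P\<^sup>2 + L\<^sup>2) / \<omega>\<^sup>2) (2 * P / \<omega>)"

lemma norm_osc:
  assumes "\<omega> > 0" "P > 0"
  shows "(norm (osc \<omega> (Complex P L) t))\<^sup>2 - 1 =
    norm (osc_phase \<omega> P L) * (sin (\<omega> * t) * sin (Arg (osc_phase \<omega> P L) - \<omega> * t))"
    (is "_ = ?K * (_ * sin (?\<phi> - _))")
proof -
  have "osc_phase \<omega> P L \<noteq> 0" using assms by (auto simp: osc_phase_def complex_eq_iff)
  then have c: "?K * cos ?\<phi> = 1 - (P\<^sup>2 + L\<^sup>2) / \<omega>\<^sup>2" "?K * sin ?\<phi> = 2 * P / \<omega>"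
    using cis_Arg[of "osc_phase \<omega> P L"] by (auto simp: complex_eq_iff osc_phase_def)
  let ?s = "sin (\<omega> * t)" and ?c = "cos (\<omega> * t)"
  \<comment> \<open>Writing 1 as \<open>s\<^sup>2 + c\<^sup>2\<close> makes the expression
    homogeneous in \<open>s\<close> and \<open>c\<close>; the terms in \<open>c\<^sup>2\<close>
    cancel and a factor \<open>s\<close> splits off.\<close>
  have alg: "(c + s / \<omega> * P)\<^sup>2 + (s / \<omega> * L)\<^sup>2 - (s\<^sup>2 + c\<^sup>2) =
      s * (2 * P / \<omega> * c - (1 - (P\<^sup>2 + L\<^sup>2) / \<omega>\<^sup>2) * s)" for s c
    using assms by (simp add: field_simps power2_eq_square)
  have "(norm (osc \<omega> (Complex P L) t))\<^sup>2 - 1 = (?c + ?s / \<omega> * P)\<^sup>2 + (?s / \<omega> * L)\<^sup>2 - (?s\<^sup>2 + ?c\<^sup>2)"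
    by (simp add: cmod_power2 osc_def)
  also have "\<dots> = ?s * (2 * P / \<omega> * ?c - (1 - (P\<^sup>2 + L\<^sup>2) / \<omega>\<^sup>2) * ?s)"
    by (rule alg)
  also have "\<dots> = ?K * (?s * sin (?\<phi> - \<omega> * t))"
    unfolding c[symmetric] sin_diff by (simp add: algebra_simps)
  finally show ?thesis .
qed

text \<open>The cosine and sine of the phase are known rationally up to its modulus
  \<open>K\<close>; inserting them makes the position a positive multiple of the stated number. The
  position has norm 1 at this time, so it equals its own \<open>sgn\<close>. The radial velocity is
  reversed and the angular momentum kept.\<close>

lemma osc_at_Arg_phase:
  fixes L :: real
  assumes "\<omega> > 0" "P > 0"
  defines "S \<equiv> Arg (osc_phase \<omega> P L) / \<omega>"
  shows "osc \<omega> (Complex P L) S = sgn (Complex (\<omega>\<^sup>2 + P\<^sup>2 - L\<^sup>2) (2 * P * L))"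
    and "osc_velocity \<omega> (Complex P L) S = osc \<omega> (Complex P L) S * Complex (- P) L"
proof -
  let ?\<phi> = "Arg (osc_phase \<omega> P L)"
  define K where "K = norm (osc_phase \<omega> P L)"
  let ?W = "Complex (\<omega>\<^sup>2 + P\<^sup>2 - L\<^sup>2) (2 * P * L)" and ?X = "osc \<omega> (Complex P L) S"
  have S: "\<omega> * S = ?\<phi>" using assms by simp
  have 0: "osc_phase \<omega> P L \<noteq> 0" using assms by (auto simp: osc_phase_def complex_eq_iff)
  then have K: "K > 0" by (simp add: K_def)
  have c: "cos ?\<phi> = (1 - (P\<^sup>2 + L\<^sup>2) / \<omega>\<^sup>2) / K" "sin ?\<phi> = 2 * P / \<omega> / K"
    using cis_Arg[OF 0] unfolding K_def by (auto simp: complex_eq_iff osc_phase_def)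
  have X: "?X = of_real (inverse (\<omega>\<^sup>2 * K)) * ?W"
    unfolding osc_def S c using K assms(1)
    by (simp add: complex_eq_iff field_simps) (simp add: power2_eq_square power4_eq_xxxx algebra_simps)
  have "(norm ?X)\<^sup>2 = 1" using norm_osc[OF assms(1,2), of L S] S by simp
  then have "norm ?X = 1" using norm_ge_zero[of ?X] by (simp add: power2_eq_1_iff)
  then have "?X = sgn ?X" by (simp add: sgn_div_norm)
  also have "\<dots> = sgn ?W"
    unfolding X using K assms(1) by (simp add: sgn_mult sgn_of_real del: of_real_inverse of_real_mult)
  finally show "?X = sgn ?W" .
  show "osc_velocity \<omega> (Complex P L) S = ?X * Complex (- P) L"
    unfolding osc_def osc_velocity_def S c using K assms(1)
    by (simp add: complex_eq_iff field_simps) (simp add: power2_eq_square power4_eq_xxxx algebra_simps)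
qed

text \<open>With the phase in (0, pi), both sine factors of \<open>norm_osc\<close> are positive
  strictly between departure and the return time, so the orbit stays outside the disk.\<close>

lemma Arg_osc_phase:
  assumes "\<omega> > 0" "P > 0"
  shows "0 < Arg (osc_phase \<omega> P L)" "Arg (osc_phase \<omega> P L) < pi"
proof -
  have "Im (osc_phase \<omega> P L) > 0" using assms by (simp add: osc_phase_def)
  then show "0 < Arg (osc_phase \<omega> P L)" "Arg (osc_phase \<omega> P L) < pi"
    by (simp_all add: Arg_lt_pi[THEN iffD2])
qed

lemma norm_osc_phase_pos: "\<omega> > 0 \<Longrightarrow> P > 0 \<Longrightarrow> norm (osc_phase \<omega> P L) > 0"
  by (auto simp: osc_phase_def complex_eq_iff)

lemma outer_arc_endpoint:
  assumes arc: "outer_arc \<omega> \<E> x v S" and pos: "\<omega> > 0" "P > 0" and v0: "v 0 = x 0 * Complex P L"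
  shows "x S = x 0 * sgn (Complex (\<omega>\<^sup>2 + P\<^sup>2 - L\<^sup>2) (2 * P * L))" "v S = x S * Complex (- P) L"
proof -
  let ?\<phi> = "Arg (osc_phase \<omega> P L)"
  let ?N = "\<lambda>t. sin (\<omega> * t) * sin (?\<phi> - \<omega> * t)"
  have S: "0 < S" and m: "motion (V_E \<omega> \<E>) UNIV x v {0..S}" and x: "norm (x 0) = 1" "norm (x S) = 1"
    and out: "\<And>t. 0 < t \<Longrightarrow> t < S \<Longrightarrow> norm (x t) > 1"
    using arc by (auto simp: outer_arc_def not_le)
  have eq: "x t = x 0 * osc \<omega> (Complex P L) t" "v t = x 0 * osc_velocity \<omega> (Complex P L) t"
    if "t \<in> {0..S}" for t
    using motion_V_E_eq_osc[OF m _ v0 that] pos by auto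
  have N: "(norm (x t))\<^sup>2 - 1 = norm (osc_phase \<omega> P L) * ?N t" if "t \<in> {0..S}" for t
    using eq(1)[OF that] norm_osc[OF pos, of L t] x by (simp add: norm_mult)
  note K = norm_osc_phase_pos[OF pos, of L] and \<phi> = Arg_osc_phase[OF pos, of L]
  \<comment> \<open>\<open>?\<phi> / \<omega>\<close> is the first positive zero of
    \<open>?N\<close>: a longer arc would meet the circle at an interior time, and a shorter one
    would end strictly outside the disk.\<close>
  have "S = ?\<phi> / \<omega>"
  proof (rule antisym)
    show "S \<le> ?\<phi> / \<omega>"
    proof (rule ccontr)
      assume "\<not> S \<le> ?\<phi> / \<omega>"
      then have "norm (x (?\<phi> / \<omega>)) > 1" "?\<phi> / \<omega> \<in> {0..S}" using out \<phi> pos by auto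
      with N[of "?\<phi> / \<omega>"] pos show False by (simp add: power2_eq_1_iff)
    qed
    show "?\<phi> / \<omega> \<le> S"
    proof (rule ccontr)
      assume "\<not> ?\<phi> / \<omega> \<le> S"
      then have "\<omega> * S < ?\<phi>" using pos by (simp add: field_simps)
      moreover have "0 < \<omega> * S" using S pos by simp
      ultimately have "?N S > 0" using \<phi> by (intro mult_pos_pos[OF sin_gt_zero sin_gt_zero]) linarith+
      then have "norm (osc_phase \<omega> P L) * ?N S > 0" using K by simp
      moreover have "norm (osc_phase \<omega> P L) * ?N S = 0" using N[of S] S x by simp
      ultimately show False by linarith
    qed
  qed
  then show "x S = x 0 * sgn (Complex (\<omega>\<^sup>2 + P\<^sup>2 - L\<^sup>2) (2 * P * L))" "v S = x S * Complex (- P) L"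
    using osc_at_Arg_phase[OF pos, of L] eq[of S] S by auto
qed

lemma outer_arc_exists:
  assumes pos: "\<omega> > 0" "P > 0" and p: "norm p = 1" and e: "P\<^sup>2 + L\<^sup>2 = 2 * \<E> - \<omega>\<^sup>2"
  obtains x v S where "outer_arc \<omega> \<E> x v S" "x 0 = p" "v 0 = p * Complex P L"
proof -
  let ?c = "Complex P L"
  define S where "S = Arg (osc_phase \<omega> P L) / \<omega>"
  define x v where "x t = p * osc \<omega> ?c t" and "v t = p * osc_velocity \<omega> ?c t" for t
  note K = norm_osc_phase_pos[OF pos, of L] and \<phi> = Arg_osc_phase[OF pos, of L]
  have S: "S > 0" "\<omega> * S = Arg (osc_phase \<omega> P L)" using \<phi> pos by (auto simp: S_def)
  have n: "(norm (x t))\<^sup>2 - 1 = norm (osc_phase \<omega> P L) * (sin (\<omega> * t) * sin (\<omega> * S - \<omega> * t))" for t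
    using norm_osc[OF pos, of L t] p by (simp add: x_def norm_mult S(2))
  have d: "(x has_vector_derivative v t) (at t within J)"
      "(v has_vector_derivative (- \<omega>\<^sup>2) *\<^sub>R x t) (at t within J)" for t J
    unfolding x_def v_def
    using osc_has_vector_derivative[of \<omega> ?c t J] pos
    by (auto intro!: derivative_eq_intros)
  have en: "(norm (v t))\<^sup>2 / 2 = V_E \<omega> \<E> (x t)" for t
  proof -
    let ?s = "sin (\<omega> * t)" and ?k = "cos (\<omega> * t)"
    have alg: "(- \<omega> * s + k * P)\<^sup>2 + (k * L)\<^sup>2 + \<omega>\<^sup>2 * ((k + s / \<omega> * P)\<^sup>2 + (s / \<omega> * L)\<^sup>2)
        = (s\<^sup>2 + k\<^sup>2) * (\<omega>\<^sup>2 + (P\<^sup>2 + L\<^sup>2))" for s k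
      using pos by (simp add: field_simps power2_eq_square)
    have "(norm (v t))\<^sup>2 + \<omega>\<^sup>2 * (norm (x t))\<^sup>2 =
      (- \<omega> * ?s + ?k * P)\<^sup>2 + (?k * L)\<^sup>2 + \<omega>\<^sup>2 * ((?k + ?s / \<omega> * P)\<^sup>2 + (?s / \<omega> * L)\<^sup>2)"
      using p by (simp add: x_def v_def norm_mult cmod_power2 osc_def osc_velocity_def)
    also have "\<dots> = (?s\<^sup>2 + ?k\<^sup>2) * (\<omega>\<^sup>2 + (P\<^sup>2 + L\<^sup>2))" by (rule alg)
    finally show ?thesis by (simp add: e V_E_def)
  qed
  have "motion (V_E \<omega> \<E>) UNIV x v {0..S}"
    unfolding motion_def using d en GDERIV_V_E by blast
  moreover have "norm (x 0) = 1" "x 0 = p" "v 0 = p * ?c"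
    using p by (auto simp: x_def v_def osc_def osc_velocity_def)
  moreover have "(norm (x S))\<^sup>2 - 1 = 0" unfolding n by simp
  then have "norm (x S) = 1" using norm_ge_zero[of "x S"] by (simp add: power2_eq_1_iff)
  moreover have "norm (x t) > 1" if "t \<in> {0<..<S}" for t
  proof -
    have "0 < \<omega> * t" "\<omega> * t < \<omega> * S" using that pos by auto
    moreover have "\<omega> * S < pi" unfolding S(2) by (rule \<phi>)
    ultimately have "0 < \<omega> * t" "\<omega> * t < pi" "0 < \<omega> * S - \<omega> * t" "\<omega> * S - \<omega> * t < pi" by linarith+
    then have "sin (\<omega> * t) * sin (\<omega> * S - \<omega> * t) > 0"
      by (intro mult_pos_pos[OF sin_gt_zero sin_gt_zero])
    then have "norm (osc_phase \<omega> P L) * (sin (\<omega> * t) * sin (\<omega> * S - \<omega> * t)) > 0" using K by simp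
    then have "1\<^sup>2 < (norm (x t))\<^sup>2" using n[of t] by simp
    then show ?thesis by (rule power_less_imp_less_base) simp
  qed
  ultimately have "outer_arc \<omega> \<E> x v S"
    unfolding outer_arc_def using S by (auto simp: not_le)
  then show ?thesis using that \<open>x 0 = p\<close> \<open>v 0 = p * ?c\<close> by blast
qed

section \<open>Inner arcs\<close>

lemma GDERIV_V_I:
  assumes "z \<noteq> 0"
  shows "GDERIV (V_I \<E> h \<mu>) z :> (- \<mu> / norm z ^ 3) *\<^sub>R z"
proof -
  have "((\<lambda>r. \<E> + h + \<mu> / r) has_real_derivative - \<mu> / (norm z)\<^sup>2) (at (norm z))"
    using assms by (auto intro!: derivative_eq_intros simp: power2_eq_square)
  from GDERIV_DERIV_compose[OF GDERIV_norm[OF assms] this] show ?thesis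
    by (simp add: V_I_def [abs_def] sgn_div_norm power2_eq_square power3_eq_cube divide_inverse mult_ac)
qed

text \<open>The second conserved quantity is the Laplace--Runge--Lenz vector.\<close>

lemma kepler_conserved:
  assumes m: "motion (V_I \<E> h \<mu>) (- {0}) z v {0..T}" and t: "t \<in> {0..T}"
    and L: "L = Im (cnj (z 0) * v 0)"
  shows "Im (cnj (z t) * v t) = L"
    and "- \<i> * L * v t - \<mu> * sgn (z t) = - \<i> * L * v 0 - \<mu> * sgn (z 0)"
proof -
  have z0: "z s \<noteq> 0" if "s \<in> {0..T}" for s using m that by (auto simp: motion_def)
  have dz: "(z has_vector_derivative v s) (at s within {0..T})"
    and dv: "(v has_vector_derivative of_real (- \<mu> / norm (z s) ^ 3) * z s) (at s within {0..T})"
    if "s \<in> {0..T}" for s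
    using motion_has_vector_derivative[OF m that] GDERIV_V_I[OF z0[OF that], of \<E> h \<mu>]
    by (auto simp: scaleR_conv_of_real)
  have dcz: "((\<lambda>s. cnj (z s)) has_vector_derivative cnj (v s)) (at s within {0..T})"
    if "s \<in> {0..T}" for s
    using bounded_linear.has_vector_derivative[OF bounded_linear_cnj dz[OF that]] .
  have "Im (cnj (z s) * v s) = L" if s: "s \<in> {0..T}" for s
    unfolding L
  proof (rule eq_at_0_if_derivative_0[OF _ s])
    fix s assume s: "s \<in> {0..T}"
    have "((\<lambda>s. cnj (z s) * v s) has_vector_derivative
        cnj (z s) * (of_real (- \<mu> / norm (z s) ^ 3) * z s) + cnj (v s) * v s) (at s within {0..T})"
      by (intro has_vector_derivative_mult dcz dv s)
    from bounded_linear.has_vector_derivative[OF bounded_linear_Im this]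
    show "((\<lambda>s. Im (cnj (z s) * v s)) has_vector_derivative 0) (at s within {0..T})"
      by (simp add: algebra_simps)
  qed
  note Ls = this
  then show "Im (cnj (z t) * v t) = L" using t .
  show "- \<i> * L * v t - \<mu> * sgn (z t) = - \<i> * L * v 0 - \<mu> * sgn (z 0)"
  proof (rule eq_at_0_if_derivative_0[OF _ t])
    fix s assume s: "s \<in> {0..T}"
    let ?r = "norm (z s)"
    have r: "?r \<noteq> 0" using z0[OF s] by simp
    have "((\<lambda>s. norm (z s)) has_derivative (\<lambda>x. inner (x *\<^sub>R v s) (sgn (z s)))) (at s within {0..T})"
      using has_derivative_compose[OF dz[OF s, unfolded has_vector_derivative_def] has_derivative_norm[OF z0[OF s]]] .
    then have dr: "((\<lambda>s. norm (z s)) has_real_derivative Re (cnj (z s) * v s) / ?r) (at s within {0..T})"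
      unfolding has_field_derivative_def
      by (rule has_derivative_eq_rhs) (auto simp: fun_eq_iff sgn_div_norm inner_complex_def divide_simps algebra_simps)
    have "((\<lambda>s. inverse (norm (z s))) has_real_derivative - (Re (cnj (z s) * v s) / ?r ^ 3)) (at s within {0..T})"
      by (rule derivative_eq_intros dr r refl)+ (use r in \<open>simp add: field_simps power3_eq_cube power2_eq_square\<close>)
    then have di: "((\<lambda>s. complex_of_real (inverse (norm (z s)))) has_vector_derivative
        of_real (- (Re (cnj (z s) * v s) / ?r ^ 3))) (at s within {0..T})"
      by (intro has_vector_derivative_of_real) (simp add: has_real_derivative_iff_has_vector_derivative)
    have "((\<lambda>s. - \<i> * L * v s - \<mu> * (of_real (inverse (norm (z s))) * z s)) has_vector_derivative
       - \<i> * L * (of_real (- \<mu> / ?r ^ 3) * z s)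
       - \<mu> * (of_real (inverse ?r) * v s + of_real (- (Re (cnj (z s) * v s) / ?r ^ 3)) * z s)) (at s within {0..T})"
      by (intro has_vector_derivative_diff has_vector_derivative_mult_right has_vector_derivative_mult di dv dz s)
    moreover have "- \<i> * L * (of_real (- \<mu> / ?r ^ 3) * z s)
       - \<mu> * (of_real (inverse ?r) * v s + of_real (- (Re (cnj (z s) * v s) / ?r ^ 3)) * z s) = 0"
    proof -
      \<comment> \<open>Splitting the velocity into radial and tangential parts shows that the
        derivative of \<open>sgn z\<close> is i L z / r^3, which cancels against the acceleration
        term.\<close>
      have "of_real (?r\<^sup>2) * v s = z s * (cnj (z s) * v s)"
        by (simp add: complex_norm_square mult_ac del: of_real_power)
      also have "cnj (z s) * v s = of_real (Re (cnj (z s) * v s)) + \<i> * L"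
        unfolding Ls[OF s, symmetric] by (rule complex_eq)
      finally have *: "of_real (?r\<^sup>2) * v s = z s * (of_real (Re (cnj (z s) * v s)) + \<i> * L)" .
      have "of_real (inverse ?r) * v s = of_real (?r\<^sup>2) * v s / of_real (?r ^ 3)"
        using r by (simp add: field_simps power2_eq_square power3_eq_cube)
      then show ?thesis
        unfolding * using r by (simp add: field_simps)
    qed
    ultimately show "((\<lambda>s. - \<i> * L * v s - \<mu> * sgn (z s)) has_vector_derivative 0) (at s within {0..T})"
      by (simp add: sgn_div_norm scaleR_conv_of_real)
  qed
qed

text \<open>On the unit circle the Laplace--Runge--Lenz vector at a point \<open>z\<close> is \<open>z\<close> times a number that is
  conjugated when the radial velocity changes sign. So the end point is determined by the initial
  data without uniqueness of solutions of the Kepler problem.\<close>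

lemma inner_arc_endpoint:
  assumes arc: "inner_arc \<E> h \<mu> y w T" and pos: "\<mu> > 0" "P > 0" "P' > 0"
    and w0: "w 0 = y 0 * Complex (- P) L" and wT: "w T = y T * Complex P' L'"
  shows "L' = L" "y T = y 0 * (sgn (Complex (L\<^sup>2 - \<mu>) (L * P)))\<^sup>2"
proof -
  let ?B = "Complex (L\<^sup>2 - \<mu>) (L * P)"
  have B: "?B \<noteq> 0" using pos by (auto simp: complex_eq_iff)
  have "L' = L \<and> y T = y 0 * (sgn ?B)\<^sup>2"
    using arc unfolding inner_arc_def
  proof
    assume reg: "regular_inner_arc \<E> h \<mu> y w T"
    then have m: "motion (V_I \<E> h \<mu>) (- {0}) y w {0..T}" and T: "0 < T"
      and n: "norm (y 0) = 1" "norm (y T) = 1" by (auto simp: regular_inner_arc_def)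
    have c: "cnj (y 0) * (y 0 * x) = x" "cnj (y T) * (y T * x) = x" for x
      using n complex_norm_square[of "y 0"] complex_norm_square[of "y T"]
      by (simp_all add: mult.commute mult.left_commute flip: mult.assoc)
    have L: "L = Im (cnj (y 0) * w 0)" by (simp add: w0 c)
    have TT: "T \<in> {0..T}" "0 \<in> {0..T}" using T by auto
    from kepler_conserved(1)[OF m TT(1) L] have L': "L' = L" by (simp add: wT c)
    have "(norm (w t))\<^sup>2 / 2 = V_I \<E> h \<mu> (y t)" if "t \<in> {0..T}" for t
      using m that by (auto simp: motion_def)
    \<comment> \<open>The potential is constant on the circle, so energy and angular momentum fix
      the radial speed.\<close>
    from this[OF TT(1)] this[OF TT(2)] have "P\<^sup>2 = P'\<^sup>2"
      using n by (simp add: w0 wT L' norm_mult cmod_power2 V_I_def)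
    then have P': "P' = P" using pos by (simp add: power2_eq_iff_nonneg)
    have s: "sgn (y T) = y T" "sgn (y 0) = y 0" using n by (simp_all add: sgn_div_norm)
    have "- \<i> * L * w T - \<mu> * y T = y T * cnj ?B" "- \<i> * L * w 0 - \<mu> * y 0 = y 0 * ?B"
      unfolding wT w0 L' P' by (simp_all add: complex_eq_iff algebra_simps power2_eq_square)
    then have "y T * cnj ?B = y 0 * ?B"
      using kepler_conserved(2)[OF m TT(1) L] unfolding s by metis
    then have "y T = y 0 * (?B / cnj ?B)" using B by (simp add: field_simps)
    also have "?B / cnj ?B = (sgn ?B)\<^sup>2"
    proof -
      have "?B / cnj ?B = ?B\<^sup>2 / (?B * cnj ?B)" using B by (simp add: power2_eq_square)
      also have "?B * cnj ?B = of_real ((norm ?B)\<^sup>2)" by (simp add: complex_norm_square del: of_real_power)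
      finally show ?thesis by (simp add: sgn_div_norm scaleR_conv_of_real power_mult_distrib divide_inverse mult.commute power_inverse)
    qed
    finally show ?thesis using L' by simp
  next
    assume ej: "ejection_collision_arc \<E> h \<mu> y w T"
    then have m: "motion (V_I \<E> h \<mu>) (- {0}) y w {0..<T/2}" and T: "0 < T"
      and n: "norm (y 0) = 1"
      and seg: "\<And>t. t \<in> {0<..<T/2} \<Longrightarrow> y t \<in> closed_segment 0 (y 0)"
      and sym: "\<forall>t\<in>{0..<T/2}. y (T - t) = y t \<and> w (T - t) = - w t"
      unfolding ejection_collision_arc_def by auto
    have yT: "y T = y 0" "w T = - w 0" using bspec[OF sym, of 0] T by simp_all
    have c: "cnj (y 0) * (y 0 * x) = x" for x
      using n complex_norm_square[of "y 0"]
      by (simp add: mult.commute mult.left_commute flip: mult.assoc)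
    have "y 0 * Complex P' L' = y 0 * Complex P (- L)"
      using wT w0 yT by (simp add: complex_eq_iff)
    moreover have "y 0 \<noteq> 0" using n by auto
    ultimately have "Complex P' L' = Complex P (- L)" by (metis mult_left_cancel)
    then have L': "L' = - L" by simp
    have "(y has_vector_derivative w 0) (at 0 within {0..<T/2})"
      using motion_has_vector_derivative(1)[OF m] T by simp
    \<comment> \<open>A closed interval inside \<open>{0..<T/2}\<close>, on which one-sided
      derivatives are unique. The component of \<open>y\<close> transversal to the segment is zero
      there and its derivative at 0 is \<open>L\<close>, so a collision arc has
      \<open>L = 0\<close>.\<close>
    then have "(y has_vector_derivative w 0) (at 0 within {0..T/4})"
      by (rule has_vector_derivative_within_subset) (use T in auto)
    then have "((\<lambda>t. Im (cnj (y 0) * y t)) has_vector_derivative Im (cnj (y 0) * w 0)) (at 0 within {0..T/4})"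
      by (intro bounded_linear.has_vector_derivative[OF bounded_linear_Im] has_vector_derivative_mult_right)
    moreover have "Im (cnj (y 0) * y t) = 0" if t: "t \<in> {0..T/4}" for t
    proof (cases "t = 0")
      case False
      then have "y t \<in> closed_segment 0 (y 0)" using seg t T by auto
      then show ?thesis by (auto simp: in_segment)
    qed simp
    then have "((\<lambda>t. Im (cnj (y 0) * y t)) has_vector_derivative 0) (at 0 within {0..T/4})"
      using T by (intro has_vector_derivative_transform[OF _ _ has_vector_derivative_const[of 0]]) auto
    ultimately have "Im (cnj (y 0) * w 0) = 0"
      using T by (intro vector_derivative_unique_within_closed_interval[of 0 "T/4" 0]) auto
    then have L0: "L = 0" by (simp add: w0 c)
    \<comment> \<open>The squared sign is then 1, so the general formula agrees with the return to
      the starting point.\<close>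
    then have "?B = of_real (- \<mu>)" by (simp add: complex_eq_iff)
    then have "sgn ?B = of_real (sgn (- \<mu>))" by (simp only: sgn_of_real)
    then have "sgn ?B = - 1" using pos by simp
    then show ?thesis using yT L' L0 by simp
  qed
  then show "L' = L" "y T = y 0 * (sgn ?B)\<^sup>2" by auto
qed

section \<open>Kepler's equation and hyperbolic motion\<close>

lemma cosh_real_gt_1: "u \<noteq> 0 \<Longrightarrow> 1 < cosh (u :: real)"
  using cosh_real_ge_1[of u] by (simp add: order_less_le)

text \<open>The eccentricity \<open>e = 1\<close>, where the derivative vanishes at \<open>u = 0\<close>, is included: it gives the
  collision orbits.\<close>

lemma kepler_equation_strict_mono:
  assumes "e \<ge> 1"
  shows "strict_mono (\<lambda>u::real. e * sinh u - u)" (is "strict_mono ?f")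
proof
  fix x y :: real assume xy: "x < y"
  have cont: "continuous_on S ?f" for S by (intro continuous_intros)
  have d: "\<exists>d. (?f has_real_derivative d) (at u) \<and> 0 < d" if "u \<noteq> 0" for u
  proof (intro exI conjI)
    show "(?f has_real_derivative e * cosh u - 1) (at u)" by (auto intro!: derivative_eq_intros)
    have "1 < cosh u" using that by (rule cosh_real_gt_1)
    also have "\<dots> \<le> e * cosh u" using mult_right_mono[of 1 e "cosh u"] assms by simp
    finally show "0 < e * cosh u - 1" by simp
  qed
  have less: "?f a < ?f b" if "a < b" "0 \<notin> {a<..<b}" for a b
    using DERIV_pos_imp_increasing_open[OF that(1) d cont] that(2) by auto
  show "?f x < ?f y"
  proof (cases "0 \<in> {x<..<y}")
    case True
    then show ?thesis using less[of x 0] less[of 0 y] by simp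
  qed (use less xy in blast)
qed

text \<open>\<open>U\<close> inverts the hyperbolic Kepler equation. It is continuous everywhere,
  but the derivative is claimed only where \<open>e * cosh (U t) > 1\<close>: for
  \<open>e = 1\<close> this leaves out the collision time.\<close>

lemma kepler_equation_solution:
  assumes e: "e \<ge> 1"
  obtains U where "\<And>u::real. U (e * sinh u - u) = u" "\<And>t. isCont U t" "\<And>t. U (- t) = - U t"
    "\<And>t. e * cosh (U t) > 1 \<Longrightarrow> (U has_real_derivative inverse (e * cosh (U t) - 1)) (at t)"
    "strict_mono U"
proof -
  let ?f = "\<lambda>u::real. e * sinh u - u"
  have mono: "strict_mono ?f" using kepler_equation_strict_mono[OF e] .
  have pos: "\<exists>u. ?f u = t" if "t \<ge> 0" for t
  proof -
    \<comment> \<open>A quadratic lower bound for \<open>sinh\<close> reduces the claim to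
      \<open>x * (x - 2) \<ge> 4 * t\<close>, which \<open>x = 4 + 2 * t\<close> satisfies.\<close>
    have "?f (4 + 2 * t) \<ge> t"
    proof -
      let ?x = "4 + 2 * t"
      have "(x + x\<^sup>2 / 2) / 2 \<le> sinh x" if "x \<ge> 0" for x :: real
      proof -
        have "exp (- x) \<le> 1" using that by simp
        from diff_mono[OF exp_lower_Taylor_quadratic[OF that] this]
        have "x + x\<^sup>2 / 2 \<le> exp x - exp (- x)" by simp
        then show ?thesis unfolding sinh_field_def by (rule divide_right_mono) simp
      qed
      then have "sinh ?x \<ge> (?x + ?x\<^sup>2 / 2) / 2" using that by simp
      moreover have "(?x + ?x\<^sup>2 / 2) / 2 \<ge> ?x + t" using that by (simp add: field_simps power2_eq_square)
      moreover have "e * sinh ?x \<ge> sinh ?x" using mult_right_mono[of 1 e "sinh ?x"] that e by simp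
      ultimately show ?thesis by linarith
    qed
    then show ?thesis
      using IVT'[of ?f 0 t "4 + 2 * t"] that by (force intro!: continuous_intros)
  qed
  have "\<exists>u. ?f u = t" for t
  proof (cases "t \<ge> 0")
    case False
    then obtain u where "?f u = - t" using pos[of "- t"] by auto
    then have "?f (- u) = t" by simp
    then show ?thesis ..
  qed (rule pos)
  then have "surj ?f" unfolding surj_def by metis
  then have bij: "bij ?f"
    using strict_mono_imp_inj_on[OF mono] by (simp add: bij_def)
  define U where "U = inv ?f"
  have U: "U (?f u) = u" "?f (U t) = t" for u t
    unfolding U_def using inv_f_f[OF bij_is_inj[OF bij], of u]
      surj_f_inv_f[OF bij_is_surj[OF bij], of t] by simp_all
  have cont: "isCont U t" for t
    using isCont_inverse_function[of 1 "U t" U ?f] U by (simp add: continuous_intros)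
  have "U (- t) = - U t" for t
    using U(1)[of "- U t"] U(2)[of t] by (simp add: algebra_simps)
  moreover have "(U has_real_derivative inverse (e * cosh (U t) - 1)) (at t)" if "e * cosh (U t) > 1" for t
  proof (rule DERIV_inverse_function[where a = "t - 1" and b = "t + 1" and f = ?f])
    show "(?f has_real_derivative e * cosh (U t) - 1) (at (U t))"
      by (auto intro!: derivative_eq_intros)
  qed (use that U(2) cont in auto)
  moreover have "strict_mono U"
  proof
    show "U s < U t" if "s < t" for s t
      using strict_mono_less[OF mono, of "U s" "U t"] U(2) that by simp
  qed
  ultimately show ?thesis using that[of U] U(1) cont by blast
qed

text \<open>Hyperbolic motion with the origin at the focus, in terms of the eccentric anomaly \<open>u\<close>; the sign
  of \<open>b\<close> is that of the angular momentum and time is \<open>\<kappa> * a * (e * sinh u - u)\<close>. For \<open>b = 0\<close> and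
  \<open>e = 1\<close> this is the ejection-collision orbit, the collision being at \<open>u = 0\<close>.\<close>

definition kepler_position :: "real \<Rightarrow> real \<Rightarrow> real \<Rightarrow> real \<Rightarrow> complex" where
  "kepler_position a b e u = Complex (a * (e - cosh u)) (b * sinh u)"

definition kepler_velocity :: "real \<Rightarrow> real \<Rightarrow> real \<Rightarrow> real \<Rightarrow> real \<Rightarrow> complex" where
  "kepler_velocity a b e \<kappa> u =
     Complex (- a * sinh u / (\<kappa> * (a * (e * cosh u - 1)))) (b * cosh u / (\<kappa> * (a * (e * cosh u - 1))))"

lemma norm_kepler_position:
  assumes "a > 0" "e \<ge> 1" "b\<^sup>2 = a\<^sup>2 * (e\<^sup>2 - 1)"
  shows "norm (kepler_position a b e u) = a * (e * cosh u - 1)"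
proof -
  have s: "(sinh u)\<^sup>2 = (cosh u)\<^sup>2 - 1" by (simp add: sinh_square_eq)
  have "(norm (kepler_position a b e u))\<^sup>2 = (a * (e * cosh u - 1))\<^sup>2"
    unfolding kepler_position_def cmod_power2 complex.sel power_mult_distrib assms(3) s
    by (simp add: power2_eq_square algebra_simps)
  moreover have "1 \<le> e * cosh u" using mult_mono[of 1 e 1 "cosh u"] assms by (simp add: cosh_real_ge_1)
  then have "a * (e * cosh u - 1) \<ge> 0" using assms by simp
  ultimately show ?thesis by (metis norm_ge_zero power2_eq_iff_nonneg)
qed

text \<open>The derivative of \<open>U\<close> expresses dt = kappa r du with r the distance to the
  origin. \<open>a = \<kappa>\<^sup>2 * \<mu>\<close> is Kepler's third law, and with the other
  equation on \<open>\<kappa>\<close> it gives \<open>a\<close> the energy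
  \<open>\<mu> / (2 * a) = \<E> + h\<close>. The constant \<open>c\<close> rotates the
  hyperbola.\<close>

lemma kepler_motion:
  assumes pos: "a > 0" "\<kappa> > 0" and e: "e \<ge> 1" "b\<^sup>2 = a\<^sup>2 * (e\<^sup>2 - 1)"
    and \<kappa>: "a = \<kappa>\<^sup>2 * \<mu>" "\<kappa>\<^sup>2 * (2 * (\<E> + h)) = 1" and lam: "norm c = 1"
    and gt: "\<And>t. t \<in> J \<Longrightarrow> e * cosh (U t) > 1"
    and U: "\<And>t. t \<in> J \<Longrightarrow> (U has_real_derivative 1 / (\<kappa> * (a * (e * cosh (U t) - 1)))) (at t)"
  shows "motion (V_I \<E> h \<mu>) (- {0}) (\<lambda>t. c * kepler_position a b e (U t))
    (\<lambda>t. c * kepler_velocity a b e \<kappa> (U t)) J"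
  unfolding motion_def
proof (intro ballI conjI)
  fix t assume t: "t \<in> J"
  let ?r = "a * (e * cosh (U t) - 1)"
  let ?z = "c * kepler_position a b e (U t)" and ?v = "c * kepler_velocity a b e \<kappa> (U t)"
  note n = norm_kepler_position[OF pos(1) e]
  have r: "?r > 0" using gt[OF t] pos by simp
  have nz: "norm ?z = ?r" by (simp add: norm_mult lam n)
  then have z: "?z \<noteq> 0" using r by force
  then show "?z \<in> - {0}" by simp
  note dU = DERIV_subset[OF U[OF t] subset_UNIV, of J]
  have "((\<lambda>t. kepler_position a b e (U t)) has_vector_derivative kepler_velocity a b e \<kappa> (U t)) (at t within J)"
    unfolding has_vector_derivative_complex_iff kepler_position_def [abs_def] kepler_velocity_def [abs_def] complex.sel
    by (auto intro!: derivative_eq_intros dU)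
  then show "((\<lambda>t. c * kepler_position a b e (U t)) has_vector_derivative ?v) (at t within J)"
    by (rule has_vector_derivative_mult_right)
  have s: "(sinh u)\<^sup>2 = (cosh u)\<^sup>2 - 1" for u :: real by (simp add: sinh_square_eq)
  have acc: "(- \<mu> / ?r ^ 3) * x = - a * x / (\<kappa>\<^sup>2 * ?r ^ 3)" for x using \<kappa> pos by (simp add: field_simps)
  have dv: "((\<lambda>t. kepler_velocity a b e \<kappa> (U t)) has_vector_derivative (- \<mu> / ?r ^ 3) *\<^sub>R kepler_position a b e (U t)) (at t within J)"
  proof -
    define r where "r = ?r"
    have "r > 0" using r by (simp add: r_def)
    define C S where "C = cosh (U t)" and "S = sinh (U t)"
    have rC: "a * (e * C - 1) = r" by (simp add: r_def C_def)
    have SS: "S * S = C * C - 1" using s[of "U t"] by (simp add: C_def S_def power2_eq_square)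
    have d1: "((\<lambda>t. \<kappa> * (a * (e * cosh (U t) - 1))) has_real_derivative a * e * S / r) (at t within J)"
      using \<open>r > 0\<close> pos by (auto intro!: derivative_eq_intros dU simp: r_def S_def)
    have d2: "((\<lambda>t. - a * sinh (U t)) has_real_derivative - a * C / (\<kappa> * r)) (at t within J)"
      by (auto intro!: derivative_eq_intros dU simp: r_def C_def)
    have d3: "((\<lambda>t. b * cosh (U t)) has_real_derivative b * S / (\<kappa> * r)) (at t within J)"
      by (auto intro!: derivative_eq_intros dU simp: r_def S_def)
    have nz: "\<kappa> * (a * (e * cosh (U t) - 1)) \<noteq> 0" using mult_pos_pos[OF pos(2) r] by linarith
    have "((\<lambda>t. - a * sinh (U t) / (\<kappa> * (a * (e * cosh (U t) - 1)))) has_real_derivative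
        (- a * C / (\<kappa> * r) * (\<kappa> * r) - - a * S * (a * e * S / r)) / ((\<kappa> * r) * (\<kappa> * r))) (at t within J)"
      using DERIV_divide[OF d2 d1 nz] by (simp add: C_def S_def r_def)
    moreover have "(- a * C / (\<kappa> * r) * (\<kappa> * r) - - a * S * (a * e * S / r)) / ((\<kappa> * r) * (\<kappa> * r))
       = - a * (a * (e - C)) / (\<kappa>\<^sup>2 * r ^ 3)"
    proof -
      have "- a * C * r + a * a * e * (S * S) = - a * (a * (e - C))"
        unfolding SS rC[symmetric] by (simp add: algebra_simps)
      then show ?thesis using \<open>r > 0\<close> pos by (simp add: field_simps power2_eq_square power3_eq_cube)
    qed
    moreover have "((\<lambda>t. b * cosh (U t) / (\<kappa> * (a * (e * cosh (U t) - 1)))) has_real_derivative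
        (b * S / (\<kappa> * r) * (\<kappa> * r) - b * C * (a * e * S / r)) / ((\<kappa> * r) * (\<kappa> * r))) (at t within J)"
      using DERIV_divide[OF d3 d1 nz] by (simp add: C_def S_def r_def)
    moreover have "(b * S / (\<kappa> * r) * (\<kappa> * r) - b * C * (a * e * S / r)) / ((\<kappa> * r) * (\<kappa> * r))
       = - a * (b * S) / (\<kappa>\<^sup>2 * r ^ 3)"
    proof -
      have "b * S * r - b * C * a * e * S = - a * (b * S)"
        unfolding rC[symmetric] by (simp add: algebra_simps)
      moreover have "(b * S / (\<kappa> * r) * (\<kappa> * r) - b * C * (a * e * S / r)) / ((\<kappa> * r) * (\<kappa> * r))
          = (b * S * r - b * C * a * e * S) / (\<kappa>\<^sup>2 * r ^ 3)"
        using \<open>r > 0\<close> pos by (simp add: field_simps power2_eq_square power3_eq_cube)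
      ultimately show ?thesis by simp
    qed
    ultimately show ?thesis
      unfolding has_vector_derivative_complex_iff kepler_position_def kepler_velocity_def [abs_def]
        complex.sel complex_scaleR acc
      by (simp add: r_def C_def S_def)
  qed
  have "((\<lambda>t. c * kepler_velocity a b e \<kappa> (U t)) has_vector_derivative (- \<mu> / norm ?z ^ 3) *\<^sub>R ?z) (at t within J)"
    using has_vector_derivative_mult_right[OF dv, of c] by (simp add: nz)
  then show "\<exists>w. GDERIV (V_I \<E> h \<mu>) ?z :> w \<and>
      ((\<lambda>t. c * kepler_velocity a b e \<kappa> (U t)) has_vector_derivative w) (at t within J)"
    using GDERIV_V_I[OF z] by blast
  have "(norm ?v)\<^sup>2 = ((a * sinh (U t))\<^sup>2 + (b * cosh (U t))\<^sup>2) / (\<kappa> * ?r)\<^sup>2"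
    by (simp add: norm_mult lam kepler_velocity_def cmod_power2 power_divide power_mult_distrib add_divide_distrib)
  \<comment> \<open>The vis-viva identity: the left side is a^2 (e^2 cosh^2 - 1), a difference of
    squares.\<close>
  also have "(a * sinh (U t))\<^sup>2 + (b * cosh (U t))\<^sup>2 = ?r * (?r + 2 * a)"
    unfolding power_mult_distrib e s by (simp add: power2_eq_square algebra_simps)
  also have "?r * (?r + 2 * a) / (\<kappa> * ?r)\<^sup>2 = 1 / \<kappa>\<^sup>2 + 2 * (a / \<kappa>\<^sup>2) / ?r"
    using r pos by (simp add: divide_simps power2_eq_square) (simp add: algebra_simps)
  also have "1 / \<kappa>\<^sup>2 = 2 * (\<E> + h)" using \<kappa>(2) pos by (simp add: field_simps)
  also have "a / \<kappa>\<^sup>2 = \<mu>" using \<kappa>(1) pos by simp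
  finally show "(norm ?v)\<^sup>2 / 2 = V_I \<E> h \<mu> ?z"
    by (simp add: V_I_def nz add_divide_distrib)
qed

text \<open>On the unit circle the radial speed is \<open>a * e * sinh u / \<kappa>\<close> and the
  angular momentum \<open>b / \<kappa>\<close>. Solving these for prescribed values dictates the
  constants of \<open>inner_arc_exists\<close>.\<close>

lemma kepler_velocity_unit_distance:
  assumes "a > 0" "b\<^sup>2 = a\<^sup>2 * (e\<^sup>2 - 1)" "\<kappa> > 0" "a * (e * cosh u - 1) = 1"
  shows "kepler_velocity a b e \<kappa> u = kepler_position a b e u * Complex (a * e * sinh u / \<kappa>) (b / \<kappa>)"
proof -
  define C S where "C = cosh u" and "S = sinh u"
  have SS: "S * S = C * C - 1"
    using sinh_square_eq[of u] by (simp add: C_def S_def power2_eq_square)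
  have eC: "a * (e * C - 1) = 1" using assms(4) by (simp add: C_def)
  have bb: "b * b = a * a * (e * e - 1)" using assms(2) by (simp add: power2_eq_square)
  have "a * (e - C) * (a * e * S) - (b * b) * S = - a * S * (a * (e * C - 1))"
    unfolding bb by (simp add: algebra_simps)
  moreover have "a * (e - C) * b + b * (a * e * (S * S)) = b * C * (a * (e * C - 1))"
    unfolding SS by (simp add: algebra_simps)
  moreover have "kepler_velocity a b e \<kappa> u = Complex (- a * S / \<kappa>) (b * C / \<kappa>)"
    using assms(4) by (simp add: kepler_velocity_def C_def S_def)
  moreover have "kepler_position a b e u = Complex (a * (e - C)) (b * S)"
    by (simp add: kepler_position_def C_def S_def)
  ultimately show ?thesis
    unfolding eC S_def[symmetric] using assms(3)
    by (simp add: complex_eq_iff diff_divide_distrib[symmetric] add_divide_distrib[symmetric] mult_ac)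
qed

lemma inner_arc_exists:
  assumes pos: "\<mu> > 0" "\<E> + h > 0" "P > 0" and p: "norm p = 1"
    and en: "P\<^sup>2 + L\<^sup>2 = 2 * (\<E> + h + \<mu>)"
  obtains y w T where "inner_arc \<E> h \<mu> y w T" "y 0 = p" "w 0 = p * Complex (- P) L"
    "w T = y T * Complex P L"
proof -
  \<comment> \<open>The energy fixes \<open>a\<close> and \<open>\<kappa>\<close>, the angular
    momentum \<open>b\<close>, the relation between semi-axes and eccentricity \<open>e\<close>, and
    the radial speed \<open>P\<close> the anomaly \<open>u1\<close> of the exit point.\<close>
  define a where "a = \<mu> / (2 * (\<E> + h))"
  define \<kappa> where "\<kappa> = 1 / sqrt (2 * (\<E> + h))"
  define b where "b = L * \<kappa>"
  define e where "e = sqrt (a\<^sup>2 + b\<^sup>2) / a"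
  define u1 where "u1 = arsinh (P * \<kappa> / (a * e))"
  have a: "a > 0" and \<kappa>: "\<kappa> > 0" using pos by (simp_all add: a_def \<kappa>_def)
  have \<kappa>2: "\<kappa>\<^sup>2 * (2 * (\<E> + h)) = 1" using pos by (simp add: \<kappa>_def power_divide)
  then have a\<kappa>: "a = \<kappa>\<^sup>2 * \<mu>" using pos by (simp add: a_def field_simps)
  have ae: "(a * e)\<^sup>2 = a\<^sup>2 + b\<^sup>2" using a by (simp add: e_def)
  have "a \<le> sqrt (a\<^sup>2 + b\<^sup>2)" by (rule real_le_rsqrt) simp
  then have e: "e \<ge> 1" using a by (simp add: e_def)
  have b2: "b\<^sup>2 = a\<^sup>2 * (e\<^sup>2 - 1)" using ae by (simp add: power_mult_distrib algebra_simps)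
  have ae0: "a * e > 0" using a e by simp
  have sh: "sinh u1 = P * \<kappa> / (a * e)" by (simp add: u1_def)
  have u1: "u1 > 0" using pos \<kappa> ae0 by (simp add: u1_def)
  have sh': "a * e * sinh u1 / \<kappa> = P" unfolding sh using a e \<kappa> by simp
  \<comment> \<open>Towards \<open>r1\<close>: by the energy relation the point of anomaly
    \<open>u1\<close> is at distance 1.\<close>
  have "(a * e * cosh u1)\<^sup>2 = (a * e)\<^sup>2 + (a * e * sinh u1)\<^sup>2"
    by (simp add: power_mult_distrib cosh_square_eq algebra_simps)
  also have "a * e * sinh u1 = P * \<kappa>" using sh' \<kappa> by (simp add: field_simps)
  also have "(a * e)\<^sup>2 + (P * \<kappa>)\<^sup>2 = a\<^sup>2 + (P\<^sup>2 + L\<^sup>2) * \<kappa>\<^sup>2"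
    unfolding ae b_def by (simp add: power_mult_distrib algebra_simps)
  also have "\<dots> = a\<^sup>2 + \<kappa>\<^sup>2 * (2 * (\<E> + h)) + 2 * (\<kappa>\<^sup>2 * \<mu>)"
    unfolding en by (simp add: algebra_simps)
  also have "\<dots> = (1 + a)\<^sup>2" unfolding \<kappa>2 a\<kappa>[symmetric] by (simp add: power2_eq_square algebra_simps)
  finally have "a * e * cosh u1 = 1 + a"
    using ae0 a cosh_real_pos[of u1] by (subst (asm) power2_eq_iff_nonneg) auto
  then have r1: "a * (e * cosh u1 - 1) = 1" by (simp add: algebra_simps)
  let ?\<zeta> = "kepler_position a b e" and ?\<nu> = "kepler_velocity a b e \<kappa>"
  note n = norm_kepler_position[OF a e b2]
  obtain V where V: "\<And>u. V (e * sinh u - u) = u" "\<And>t. isCont V t" "\<And>t. V (- t) = - V t"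
    "\<And>t. e * cosh (V t) > 1 \<Longrightarrow> (V has_real_derivative inverse (e * cosh (V t) - 1)) (at t)"
    "strict_mono V"
    using kepler_equation_solution[OF e] by blast
  \<comment> \<open>The anomaly runs from \<open>- u1\<close> to \<open>u1\<close>, so the
    pericentre, or the collision, falls at \<open>T / 2\<close>, and \<open>c\<close> rotates the
    entry point to \<open>p\<close>.\<close>
  define T where "T = 2 * (a * \<kappa>) * (e * sinh u1 - u1)"
  define U where "U t = V ((t - T / 2) / (a * \<kappa>))" for t
  define c where "c = p / ?\<zeta> (- u1)"
  define y w where "y t = c * ?\<zeta> (U t)" and "w t = c * ?\<nu> (U t)" for t
  have a\<kappa>0: "a * \<kappa> > 0" using a \<kappa> by simp
  have "e * sinh u1 - u1 > 0" using strict_monoD[OF kepler_equation_strict_mono[OF e] u1] by simp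
  then have T: "T > 0" using a\<kappa>0 by (simp add: T_def)
  have teq: "(T - T / 2) / (a * \<kappa>) = e * sinh u1 - u1" "(0 - T / 2) / (a * \<kappa>) = - (e * sinh u1 - u1)"
    using a \<kappa> by (simp_all add: T_def)
  have UT: "U T = u1" "U 0 = - u1" unfolding U_def teq V(3) V(1) by simp_all
  have Urefl: "U (T - t) = - U t" for t
  proof -
    have "T - t - T / 2 = - (t - T / 2)" by simp
    then show ?thesis unfolding U_def by (simp only: minus_divide_left[symmetric] V(3))
  qed
  have Uhalf: "U (T / 2) = 0" using V(3)[of 0] by (simp add: U_def)
  have Umono: "U s < U t" if "s < t" for s t
    unfolding U_def using that a\<kappa>0 strict_monoD[OF V(5)] by (simp add: divide_strict_right_mono)
  have dU: "(U has_real_derivative 1 / (\<kappa> * (a * (e * cosh (U t) - 1)))) (at t)"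
    if "e * cosh (U t) > 1" for t
  proof -
    have g: "((\<lambda>t. (t - T / 2) / (a * \<kappa>)) has_real_derivative 1 / (a * \<kappa>)) (at t)"
      using a\<kappa>0 by (auto intro!: derivative_eq_intros)
    from DERIV_chain2[OF V(4) g] that show ?thesis
      by (simp add: U_def [abs_def] field_simps)
  qed
  have n1: "norm (?\<zeta> u1) = 1" "norm (?\<zeta> (- u1)) = 1" unfolding n using r1 by simp_all
  then have c: "norm c = 1" using p by (simp add: c_def norm_divide)
  have y0: "y 0 = p" using n1 by (auto simp: y_def UT c_def)
  have w0: "w 0 = p * Complex (- P) L"
    using kepler_velocity_unit_distance[OF a b2 \<kappa>, of "- u1"] r1 sh' \<kappa> y0
    by (simp add: w_def y_def UT b_def mult.assoc)
  have wT: "w T = y T * Complex P L"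
    using kepler_velocity_unit_distance[OF a b2 \<kappa>, of u1] r1 sh' \<kappa>
    by (simp add: w_def y_def UT b_def mult.assoc)
  have ny: "norm (y t) = a * (e * cosh (U t) - 1)" for t
    by (simp add: y_def norm_mult c n)
  have in_ball: "norm (y t) < 1" if t: "t \<in> {0<..<T}" for t
  proof -
    have "\<bar>U t\<bar> < u1" using Umono[of 0 t] Umono[of t T] t by (auto simp: UT)
    then have "cosh \<bar>U t\<bar> < cosh u1" by (intro cosh_real_strict_mono) auto
    then have "e * cosh (U t) < e * cosh u1" using e by simp
    then have "a * (e * cosh (U t) - 1) < a * (e * cosh u1 - 1)" using a by simp
    then show ?thesis by (simp add: ny r1)
  qed
  have mot: "motion (V_I \<E> h \<mu>) (- {0}) y w J" if "\<And>t. t \<in> J \<Longrightarrow> e * cosh (U t) > 1" for J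
    unfolding y_def [abs_def] w_def [abs_def]
    using kepler_motion[OF a \<kappa> e b2 a\<kappa> \<kappa>2 c that dU] that by blast
  have n0: "norm (y 0) = 1" "norm (y T) = 1" unfolding ny UT using r1 by simp_all
  have "inner_arc \<E> h \<mu> y w T"
  proof (cases "L = 0")
    case False
    then have "b \<noteq> 0" using \<kappa> by (simp add: b_def)
    then have "e \<noteq> 1" using b2 by auto
    have "e * cosh u > 1" for u
      using \<open>e \<noteq> 1\<close> e mult_left_mono[OF cosh_real_ge_1[of u], of e] by linarith
    then show ?thesis
      unfolding inner_arc_def regular_inner_arc_def using T mot in_ball n0 by simp
  next
    case True
    then have b0: "b = 0" by (simp add: b_def)
    then have e1: "e = 1" using a by (simp add: e_def)
    have Uneg: "U t < 0" if "t < T / 2" for t using Umono[OF that] by (simp add: Uhalf)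
    have seg: "y t \<in> closed_segment 0 (y 0)" if "t \<in> {0<..<T}" for t
    proof -
      have "y t = norm (y t) *\<^sub>R y 0"
        unfolding ny using r1 by (simp add: y_def kepler_position_def b0 e1 UT complex_eq_iff algebra_simps)
      then show ?thesis using in_ball[OF that] by (auto simp: in_segment intro!: exI[of _ "norm (y t)"])
    qed
    have "isCont U (T / 2)"
      unfolding U_def using a\<kappa>0 by (intro isCont_o2[OF _ V(2)] continuous_intros) auto
    then have "isCont y (T / 2)"
      unfolding y_def kepler_position_def Complex_eq by (intro continuous_intros) auto
    moreover have yh: "y (T / 2) = 0" by (simp add: y_def Uhalf kepler_position_def e1 b0 complex_eq_iff)
    ultimately have "(y \<longlongrightarrow> 0) (at_left (T / 2))"
      by (metis isCont_def filterlim_at_split)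
    moreover have "y (T - t) = y t" "w (T - t) = - w t" for t
      by (simp_all add: y_def w_def Urefl kepler_position_def kepler_velocity_def b0 complex_eq_iff)
    moreover have "motion (V_I \<E> h \<mu>) (- {0}) y w {0..<T / 2}"
    proof (rule mot)
      show "e * cosh (U t) > 1" if "t \<in> {0..<T / 2}" for t
        using cosh_real_gt_1[of "U t"] Uneg[of t] that by (simp add: e1)
    qed
    ultimately have "ejection_collision_arc \<E> h \<mu> y w T"
      unfolding ejection_collision_arc_def using T n0 in_ball seg yh by simp
    then show ?thesis by (simp add: inner_arc_def)
  qed
  then show ?thesis using that y0 w0 wT by blast
qed

section \<open>The first return map\<close>

lemma circle_point_abs_angle: "circle_point (abs_angle x) = cis x"
  by (rule circle_point.abs_eq)

lemma abs_angle_surj: obtains x where "\<xi> = abs_angle x"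
  by (metis Quotient_abs_rep Quotient_angle)

lemma norm_circle_point [simp]: "norm (circle_point \<xi>) = 1"
  by (metis abs_angle_surj circle_point_abs_angle norm_cis)

lemma circle_point_eq_cis_iff: "circle_point \<xi> = cis x \<longleftrightarrow> \<xi> = abs_angle x"
proof -
  obtain y where "\<xi> = abs_angle y" by (rule abs_angle_surj)
  then show ?thesis by (simp add: circle_point_abs_angle cis_eq_iff angle.abs_eq_iff)
qed

text \<open>The dictionary between the angle of a velocity and its components: P = sqrt (2 V) cos
  alpha and L = sqrt 2 s. The factor \<open>\<epsilon>\<close> is used with the values -1 and 1, for
  the normal pointing inward or outward.\<close>

lemma circle_velocity_iff:
  fixes \<epsilon> :: real
  assumes "V > 0"
  shows "(\<exists>\<alpha>\<in>{-pi/2<..<pi/2}. v = sqrt (2 * V) *\<^sub>R direction (\<epsilon> *\<^sub>R p) (\<i> * p) \<alpha> \<and> sqrt V * sin \<alpha> = s)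
    \<longleftrightarrow> (\<exists>P>0. P\<^sup>2 + (sqrt 2 * s)\<^sup>2 = 2 * V \<and> v = p * Complex (\<epsilon> * P) (sqrt 2 * s))"
    (is "?l \<longleftrightarrow> ?r")
proof
  assume ?l
  then obtain \<alpha> where \<alpha>: "-pi/2 < \<alpha>" "\<alpha> < pi/2" "v = sqrt (2 * V) *\<^sub>R direction (\<epsilon> *\<^sub>R p) (\<i> * p) \<alpha>"
    "sqrt V * sin \<alpha> = s" by auto
  have "cos \<alpha> > 0" using \<alpha> by (intro cos_gt_zero_pi) auto
  moreover have "2 * (V * (cos \<alpha>)\<^sup>2) + 2 * (V * (sin \<alpha>)\<^sup>2) = 2 * V * ((sin \<alpha>)\<^sup>2 + (cos \<alpha>)\<^sup>2)"
    by (simp only: algebra_simps)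
  then have "(sqrt (2 * V) * cos \<alpha>)\<^sup>2 + (sqrt 2 * s)\<^sup>2 = 2 * V"
    unfolding \<alpha>(4)[symmetric] using assms by (simp add: power_mult_distrib real_sqrt_mult)
  moreover have "v = p * Complex (\<epsilon> * (sqrt (2 * V) * cos \<alpha>)) (sqrt 2 * s)"
    unfolding \<alpha>(3) \<alpha>(4)[symmetric]
    by (simp add: direction_def complex_eq_iff real_sqrt_mult algebra_simps)
  ultimately show ?r using assms by (intro exI[of _ "sqrt (2 * V) * cos \<alpha>"]) simp
next
  assume ?r
  then obtain P where P: "P > 0" "P\<^sup>2 + (sqrt 2 * s)\<^sup>2 = 2 * V" "v = p * Complex (\<epsilon> * P) (sqrt 2 * s)" by auto
  have "P\<^sup>2 > 0" using P(1) by simp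
  moreover have "(sqrt 2 * s)\<^sup>2 = 2 * s\<^sup>2" by (simp add: power_mult_distrib)
  ultimately have "s\<^sup>2 < V" using P(2) by linarith
  then have "s\<^sup>2 < (sqrt V)\<^sup>2" using assms by simp
  then have "\<bar>s\<bar> < sqrt V" using assms by (simp add: real_less_rsqrt)
  then have x: "-1 < s / sqrt V" "s / sqrt V < 1" using assms by (simp_all add: field_simps abs_less_iff)
  define \<alpha> where "\<alpha> = arcsin (s / sqrt V)"
  have \<alpha>: "-pi/2 < \<alpha>" "\<alpha> < pi/2" unfolding \<alpha>_def using arcsin_lt_bounded[OF x] by auto
  have s: "sqrt V * sin \<alpha> = s" using x assms by (simp add: \<alpha>_def)
  have "(sqrt (2 * V) * cos \<alpha>)\<^sup>2 = 2 * V * (1 - (sin \<alpha>)\<^sup>2)"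
    using assms by (simp add: power_mult_distrib cos_squared_eq)
  also have "\<dots> = 2 * V - (sqrt 2 * s)\<^sup>2"
    unfolding s[symmetric] using assms by (simp add: power_mult_distrib algebra_simps)
  also have "\<dots> = P\<^sup>2" using P(2) by simp
  finally have "(sqrt (2 * V) * cos \<alpha>)\<^sup>2 = P\<^sup>2" .
  moreover have "cos \<alpha> > 0" using \<alpha> by (intro cos_gt_zero_pi) auto
  ultimately have "P = sqrt (2 * V) * cos \<alpha>"
    using P(1) assms by (subst (asm) power2_eq_iff_nonneg) auto
  then have "v = sqrt (2 * V) *\<^sub>R direction (\<epsilon> *\<^sub>R p) (\<i> * p) \<alpha>"
    unfolding P(3) s[symmetric] by (simp add: direction_def complex_eq_iff real_sqrt_mult algebra_simps)
  then show ?l using \<alpha> s by auto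
qed

text \<open>The quantity equated by Snell's law is L / sqrt 2. Refraction therefore keeps
  \<open>L\<close> and adapts the normal speed to the new potential, the sign of the normal
  component being unchanged.\<close>

lemma refracts_iff:
  fixes \<epsilon> :: real
  assumes "V > 0" "W > 0"
  shows "refracts V W (\<epsilon> *\<^sub>R p) (\<i> * p) v w \<longleftrightarrow>
    (\<exists>L. \<exists>P>0. \<exists>Q>0. P\<^sup>2 + L\<^sup>2 = 2 * V \<and> Q\<^sup>2 + L\<^sup>2 = 2 * W \<and>
       v = p * Complex (\<epsilon> * P) L \<and> w = p * Complex (\<epsilon> * Q) L)" (is "_ \<longleftrightarrow> ?r")
proof -
  let ?A = "\<lambda>V v s. \<exists>\<alpha>\<in>{-pi/2<..<pi/2}. v = sqrt (2 * V) *\<^sub>R direction (\<epsilon> *\<^sub>R p) (\<i> * p) \<alpha> \<and> sqrt V * sin \<alpha> = s"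
  have "refracts V W (\<epsilon> *\<^sub>R p) (\<i> * p) v w \<longleftrightarrow> (\<exists>s. ?A V v s \<and> ?A W w s)"
    unfolding refracts_def by metis
  also have "\<dots> \<longleftrightarrow> (\<exists>s. (\<exists>P>0. P\<^sup>2 + (sqrt 2 * s)\<^sup>2 = 2 * V \<and> v = p * Complex (\<epsilon> * P) (sqrt 2 * s)) \<and>
      (\<exists>Q>0. Q\<^sup>2 + (sqrt 2 * s)\<^sup>2 = 2 * W \<and> w = p * Complex (\<epsilon> * Q) (sqrt 2 * s)))"
    unfolding circle_velocity_iff[OF assms(1)] circle_velocity_iff[OF assms(2)] ..
  also have "\<dots> \<longleftrightarrow> ?r" (is "?m \<longleftrightarrow> _")
  proof
    assume ?m then show ?r by blast
  next
    assume ?r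
    then obtain L P Q where LPQ: "P > 0" "Q > 0" "P\<^sup>2 + L\<^sup>2 = 2 * V" "Q\<^sup>2 + L\<^sup>2 = 2 * W"
       "v = p * Complex (\<epsilon> * P) L" "w = p * Complex (\<epsilon> * Q) L" by auto
    have "sqrt 2 * (L / sqrt 2) = L" by simp
    then show ?m using LPQ by (intro exI[of _ "L / sqrt 2"]) auto
  qed
  finally show ?thesis .
qed

lemma refracts_inward_iff:
  assumes "V > 0" "W > 0"
  shows "refracts V W (- p) (\<i> * p) v w \<longleftrightarrow>
    (\<exists>L. \<exists>P>0. \<exists>Q>0. P\<^sup>2 + L\<^sup>2 = 2 * V \<and> Q\<^sup>2 + L\<^sup>2 = 2 * W \<and>
       v = p * Complex (- P) L \<and> w = p * Complex (- Q) L)"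
  using refracts_iff[OF assms, of "- 1" p v w] by simp

lemma refracts_outward_iff:
  assumes "V > 0" "W > 0"
  shows "refracts V W p (\<i> * p) v w \<longleftrightarrow>
    (\<exists>L. \<exists>P>0. \<exists>Q>0. P\<^sup>2 + L\<^sup>2 = 2 * V \<and> Q\<^sup>2 + L\<^sup>2 = 2 * W \<and>
       v = p * Complex P L \<and> w = p * Complex Q L)"
  using refracts_iff[OF assms, of 1 p v w] by simp

text \<open>Identifies the product P L, met in both rotation numbers, with the imaginary part of
  \<open>bend_number\<close>. The action is strictly admissible because the normal speed is
  nonzero.\<close>

lemma normal_times_tangential:
  fixes s :: real
  assumes "P > 0" "P\<^sup>2 + (sqrt 2 * I)\<^sup>2 = 2 * s"
  shows "I\<^sup>2 < s" "P * (sqrt 2 * I) = 2 * I * sqrt (s - I\<^sup>2)"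
proof -
  have P: "P\<^sup>2 = 2 * (s - I\<^sup>2)" using assms(2) by (simp add: power_mult_distrib)
  have "P\<^sup>2 > 0" using assms by simp
  then show "I\<^sup>2 < s" using P by simp
  have "P = sqrt (2 * (s - I\<^sup>2))" using P assms(1) by (metis less_imp_le real_sqrt_unique)
  then have "P * (sqrt 2 * I) = (sqrt 2 * sqrt 2) * (I * sqrt (s - I\<^sup>2))"
    by (simp only: real_sqrt_mult mult_ac)
  then show "P * (sqrt 2 * I) = 2 * I * sqrt (s - I\<^sup>2)" by simp
qed

lemma cis_f_shift:
  assumes "0 < \<E>" "P > 0" "P\<^sup>2 + (sqrt 2 * I)\<^sup>2 = 2 * (\<E> - \<omega>\<^sup>2 / 2)"
  shows "sgn (Complex (\<omega>\<^sup>2 + P\<^sup>2 - (sqrt 2 * I)\<^sup>2) (2 * P * (sqrt 2 * I))) = cis (f_shift \<omega> \<E> I)"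
proof -
  note n = normal_times_tangential[OF assms(2,3)]
  have "\<omega>\<^sup>2 + P\<^sup>2 - (sqrt 2 * I)\<^sup>2 = 2 * (\<E> - 2 * I\<^sup>2)"
    using assms(3) by (simp add: power_mult_distrib algebra_simps)
  moreover have "2 * P * (sqrt 2 * I) = 2 * (2 * I * sqrt (\<E> - \<omega>\<^sup>2 / 2 - I\<^sup>2))"
    using n(2) by (simp only: mult.assoc)
  ultimately have "Complex (\<omega>\<^sup>2 + P\<^sup>2 - (sqrt 2 * I)\<^sup>2) (2 * P * (sqrt 2 * I)) =
      of_real 2 * bend_number \<E> (\<E> - \<omega>\<^sup>2 / 2) I"
    by (simp add: bend_number_def complex_eq_iff)
  then show ?thesis
    using cis_bend[OF assms(1) n(1)] f_shift_eq_bend[OF assms(1) n(1)]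
    by (simp add: sgn_mult sgn_of_real del: of_real_numeral)
qed

text \<open>The number on the left is minus the conjugate of \<open>bend_number\<close>: conjugation
  reverses the bend, and squaring doubles it and removes the sign.\<close>

lemma cis_g_shift:
  assumes "0 < \<mu>" "P > 0" "P\<^sup>2 + (sqrt 2 * I)\<^sup>2 = 2 * (\<E> + h + \<mu>)"
  shows "(sgn (Complex ((sqrt 2 * I)\<^sup>2 - \<mu>) (sqrt 2 * I * P)))\<^sup>2 = cis (g_shift \<E> h \<mu> I)"
proof -
  note n = normal_times_tangential[OF assms(2,3)]
  let ?b = "bend \<mu> (\<E> + h + \<mu>) I"
  have "sqrt 2 * I * P = 2 * I * sqrt (\<E> + h + \<mu> - I\<^sup>2)" using n(2) by (simp add: mult_ac)
  then have "Complex ((sqrt 2 * I)\<^sup>2 - \<mu>) (sqrt 2 * I * P) = - cnj (bend_number \<mu> (\<E> + h + \<mu>) I)"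
    by (simp add: bend_number_def complex_eq_iff power_mult_distrib)
  moreover have "sgn (- cnj z) = - cnj (sgn z)" for z
    by (simp add: sgn_div_norm)
  moreover have "cnj (sgn (bend_number \<mu> (\<E> + h + \<mu>) I)) = cis (- ?b)"
    unfolding cis_bend[OF assms(1) n(1), symmetric] cis_cnj ..
  ultimately have "(sgn (Complex ((sqrt 2 * I)\<^sup>2 - \<mu>) (sqrt 2 * I * P)))\<^sup>2 = (cis (- ?b))\<^sup>2"
    by simp
  also have "\<dots> = cis (- 2 * ?b)" by (simp add: power2_eq_square cis_mult)
  finally show ?thesis using g_shift_eq_bend[OF assms(1) n(1)] by simp
qed

lemma outgoing_velocity_unit:
  assumes "norm p = 1"
  shows "outgoing_velocity \<omega> \<E> p \<alpha> = p * Complex (sqrt 2 * (I_c \<omega> \<E> * cos \<alpha>)) (sqrt 2 * (I_c \<omega> \<E> * sin \<alpha>))"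
  unfolding outgoing_velocity_def V_E_def assms power_one mult_1_right real_sqrt_mult I_c_def[symmetric]
  by (simp add: direction_def complex_eq_iff algebra_simps)

section \<open>The first return in angle and action coordinates\<close>

locale refraction_billiard =
  fixes \<omega> \<E> h \<mu> :: real
  assumes \<omega>: "\<omega> > 0" and \<E>: "\<E> > \<omega>\<^sup>2" and h: "h > 0" and \<mu>: "\<mu> > 0"
begin

abbreviation "Ic \<equiv> I_c \<omega> \<E>"

lemma energy_pos: "\<E> > 0" "\<E> - \<omega>\<^sup>2 / 2 > 0"
  using \<E> zero_le_power2[of \<omega>] by linarith+

lemma Ic: "Ic > 0" "Ic\<^sup>2 = \<E> - \<omega>\<^sup>2 / 2"
  using energy_pos by (simp_all add: I_c_def)

lemma V_on_circle:
  assumes "norm p = 1"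
  shows "V_E \<omega> \<E> p = \<E> - \<omega>\<^sup>2 / 2" "V_I \<E> h \<mu> p = \<E> + h + \<mu>"
  using assms by (simp_all add: V_E_def V_I_def)

lemma V_pos: "\<E> - \<omega>\<^sup>2 / 2 > 0" "\<E> + h + \<mu> > 0"
  using energy_pos h \<mu> by simp_all

lemma square_less_iff_mem: "x\<^sup>2 < \<E> - \<omega>\<^sup>2 / 2 \<longleftrightarrow> x \<in> {- Ic<..<Ic}"
  unfolding Ic(2)[symmetric] using abs_le_square_iff[of Ic x] Ic(1) by auto

text \<open>In the admissible range an angle is determined by L = sqrt 2 * \<open>Ic\<close> * sin
  alpha. This \<open>L\<close> survives both arcs and both refractions, so the exit angle is the
  initial one, and the point is multiplied by the two rotation numbers.\<close>

lemma first_return_iff: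
  assumes \<alpha>: "\<alpha>\<^sub>0 \<in> {-pi/2<..<pi/2}"
  shows "first_return \<omega> \<E> h \<mu> (\<xi>\<^sub>0, \<alpha>\<^sub>0) (\<xi>\<^sub>1, \<alpha>\<^sub>1) \<longleftrightarrow>
    \<alpha>\<^sub>1 = \<alpha>\<^sub>0 \<and> circle_point \<xi>\<^sub>1 = circle_point \<xi>\<^sub>0 * cis (theta_bar \<omega> \<E> h \<mu> (Ic * sin \<alpha>\<^sub>0))"
    (is "?l \<longleftrightarrow> ?r")
proof -
  define I where "I = Ic * sin \<alpha>\<^sub>0"
  define L where "L = sqrt 2 * I"
  define P where "P = sqrt 2 * (Ic * cos \<alpha>\<^sub>0)"
  have "cos \<alpha>\<^sub>0 > 0" using \<alpha> by (intro cos_gt_zero_pi) auto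
  then have P: "P > 0" using Ic by (simp add: P_def)
  have "P\<^sup>2 + L\<^sup>2 = 2 * Ic\<^sup>2 * ((sin \<alpha>\<^sub>0)\<^sup>2 + (cos \<alpha>\<^sub>0)\<^sup>2)"
    unfolding P_def L_def I_def power_mult_distrib distrib_left by simp
  then have PL: "P\<^sup>2 + L\<^sup>2 = 2 * (\<E> - \<omega>\<^sup>2 / 2)"
    by (simp only: Ic(2) sin_cos_squared_add mult_1_right)
  let ?p0 = "circle_point \<xi>\<^sub>0" and ?q = "circle_point \<xi>\<^sub>1"
  have v0: "outgoing_velocity \<omega> \<E> ?p0 \<alpha>\<^sub>0 = ?p0 * Complex P L"
    using outgoing_velocity_unit[of ?p0] by (simp add: P_def L_def I_def)
  note f = cis_f_shift[OF energy_pos(1) P PL[unfolded L_def], folded L_def]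
  note g = cis_g_shift[where I = I, OF \<mu>, folded L_def]
  have theta: "cis (theta_bar \<omega> \<E> h \<mu> I) = cis (f_shift \<omega> \<E> I) * cis (g_shift \<E> h \<mu> I)"
    by (simp add: theta_bar_def cis_mult)
  show ?thesis
  proof
    assume ?l
    then obtain x v S y w T p where \<alpha>1: "\<alpha>\<^sub>1 \<in> {-pi/2<..<pi/2}"
      and o: "outer_arc \<omega> \<E> x v S" "x 0 = ?p0" "v 0 = outgoing_velocity \<omega> \<E> ?p0 \<alpha>\<^sub>0" "x S = p"
      and r1: "refracts (V_E \<omega> \<E> p) (V_I \<E> h \<mu> p) (- p) (\<i> * p) (v S) (w 0)"
      and i: "inner_arc \<E> h \<mu> y w T" "y 0 = p" "y T = ?q"
      and r2: "refracts (V_I \<E> h \<mu> ?q) (V_E \<omega> \<E> ?q) ?q (\<i> * ?q) (w T) (outgoing_velocity \<omega> \<E> ?q \<alpha>\<^sub>1)"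
      unfolding first_return_def by auto
    have v: "v 0 = x 0 * Complex P L" using o v0 by simp
    note oe = outer_arc_endpoint[OF o(1) \<omega> P v]
    have p: "p = ?p0 * cis (f_shift \<omega> \<E> I)" "v S = p * Complex (- P) L"
      using oe o f by (simp_all add: L_def)
    then have np: "norm p = 1" by (simp add: norm_mult)
    then have p0: "p \<noteq> 0" by auto
    obtain Q where Q: "Q > 0" "Q\<^sup>2 + L\<^sup>2 = 2 * (\<E> + h + \<mu>)" "w 0 = p * Complex (- Q) L"
      using r1 p(2) p0 unfolding V_on_circle[OF np] refracts_inward_iff[OF V_pos] by auto
    obtain P' Q' L' where r: "P' > 0" "Q' > 0" "w T = ?q * Complex P' L'"
      "outgoing_velocity \<omega> \<E> ?q \<alpha>\<^sub>1 = ?q * Complex Q' L'"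
      using r2 unfolding V_on_circle[OF norm_circle_point] refracts_outward_iff[OF V_pos(2,1)] by auto
    have "w 0 = y 0 * Complex (- Q) L" "w T = y T * Complex P' L'" using Q r i by auto
    note ie = inner_arc_endpoint[OF i(1) \<mu> Q(1) r(1) this]
    have "?q \<noteq> 0" using norm_circle_point[of \<xi>\<^sub>1] by (metis norm_zero zero_neq_one)
    then have "sqrt 2 * (Ic * sin \<alpha>\<^sub>1) = L'"
      using r(4) unfolding outgoing_velocity_unit[OF norm_circle_point] by simp
    then have "sin \<alpha>\<^sub>1 = sin \<alpha>\<^sub>0" using ie(1) Ic by (simp add: L_def I_def)
    then have "\<alpha>\<^sub>1 = \<alpha>\<^sub>0" using \<alpha> \<alpha>1 sin_inj_pi[of \<alpha>\<^sub>1 \<alpha>\<^sub>0] by auto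
    moreover have "?q = p * cis (g_shift \<E> h \<mu> I)" using ie(2) i g[OF Q(1,2)] by simp
    ultimately show ?r using p(1) theta by (simp add: I_def mult.assoc)
  next
    assume ?r
    then have \<alpha>1: "\<alpha>\<^sub>1 = \<alpha>\<^sub>0" and q: "?q = ?p0 * cis (theta_bar \<omega> \<E> h \<mu> I)" by (auto simp: I_def)
    have "P\<^sup>2 + L\<^sup>2 = 2 * \<E> - \<omega>\<^sup>2" using PL by simp
    from outer_arc_exists[OF \<omega> P norm_circle_point this]
    obtain x v S where o: "outer_arc \<omega> \<E> x v S" "x 0 = ?p0" "v 0 = ?p0 * Complex P L" by metis
    then have "v 0 = x 0 * Complex P L" by simp
    note oe = outer_arc_endpoint[OF o(1) \<omega> P this]
    define p where "p = x S"
    have p: "p = ?p0 * cis (f_shift \<omega> \<E> I)" "v S = p * Complex (- P) L"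
      using oe o f by (simp_all add: L_def p_def)
    then have np: "norm p = 1" by (simp add: norm_mult)
    \<comment> \<open>The inner normal speed. The radicand is positive because the inner potential
      exceeds the outer one on the circle, so every outer velocity can be refracted inward.\<close>
    define Q where "Q = sqrt (2 * (\<E> + h + \<mu>) - L\<^sup>2)"
    have "2 * (\<E> + h + \<mu>) - L\<^sup>2 = P\<^sup>2 + \<omega>\<^sup>2 + 2 * (h + \<mu>)"
      using PL by (simp add: algebra_simps)
    moreover have "\<dots> > 0" using h \<mu> by (intro add_nonneg_pos) auto
    ultimately have Q: "Q > 0" "Q\<^sup>2 + L\<^sup>2 = 2 * (\<E> + h + \<mu>)" by (simp_all add: Q_def)
    have "\<E> + h > 0" using energy_pos h by simp
    from inner_arc_exists[OF \<mu> this Q(1) np Q(2)]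
    obtain y w T where i: "inner_arc \<E> h \<mu> y w T" "y 0 = p" "w 0 = p * Complex (- Q) L"
      "w T = y T * Complex Q L" by metis
    have "w 0 = y 0 * Complex (- Q) L" using i by simp
    note ie = inner_arc_endpoint[OF i(1) \<mu> Q(1) Q(1) this i(4)]
    have yq: "y T = ?q" using ie(2) i g[OF Q] p(1) q theta by (simp add: mult.assoc)
    have vq: "outgoing_velocity \<omega> \<E> ?q \<alpha>\<^sub>1 = ?q * Complex P L"
      using outgoing_velocity_unit[of ?q] by (simp add: P_def L_def I_def \<alpha>1)
    have "refracts (V_E \<omega> \<E> p) (V_I \<E> h \<mu> p) (- p) (\<i> * p) (v S) (w 0)"
      unfolding V_on_circle[OF np] refracts_inward_iff[OF V_pos] using p(2) i(3) P Q PL by blast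
    moreover have "refracts (V_I \<E> h \<mu> ?q) (V_E \<omega> \<E> ?q) ?q (\<i> * ?q) (w T) (outgoing_velocity \<omega> \<E> ?q \<alpha>\<^sub>1)"
      unfolding V_on_circle[OF norm_circle_point] refracts_outward_iff[OF V_pos(2,1)]
      using i(4) yq vq P Q PL by auto
    ultimately show ?l
      unfolding first_return_def prod.case using \<alpha> \<alpha>1 o v0 i yq p_def
      by (intro conjI, simp, simp)
        (rule exI[of _ x], rule exI[of _ v], rule exI[of _ S], rule exI[of _ y], rule exI[of _ w],
          rule exI[of _ T], rule exI[of _ p], rule exI[of _ ?q], simp)
  qed
qed

lemma action_coordinates_bij:
  "bij_betw (action_coordinates \<omega> \<E>) (UNIV \<times> {-pi/2<..<pi/2}) (UNIV \<times> {- Ic<..<Ic})"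
proof (rule bij_betwI[where g = "\<lambda>(\<xi>, I). (\<xi>, arcsin (I / Ic))"])
  show "action_coordinates \<omega> \<E> \<in> UNIV \<times> {-pi/2<..<pi/2} \<rightarrow> UNIV \<times> {- Ic<..<Ic}"
  proof
    fix u :: "angle \<times> real" assume "u \<in> UNIV \<times> {-pi/2<..<pi/2}"
    then obtain \<xi> \<alpha> where u: "u = (\<xi>, \<alpha>)" and \<alpha>: "\<alpha> \<in> {-pi/2<..<pi/2}" by blast
    have "cos \<alpha> > 0" using \<alpha> by (intro cos_gt_zero_pi) auto
    then have "(sin \<alpha>)\<^sup>2 < 1" using sin_cos_squared_add[of \<alpha>] zero_less_power[of "cos \<alpha>" 2] by linarith
    then have "\<bar>sin \<alpha>\<bar> < 1" by (simp add: abs_square_less_1)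
    then show "action_coordinates \<omega> \<E> u \<in> UNIV \<times> {- Ic<..<Ic}"
      using Ic mult_strict_left_mono[of "- 1" "sin \<alpha>" Ic] mult_strict_left_mono[of "sin \<alpha>" 1 Ic]
      by (simp add: u action_coordinates_def)
  qed
  have x: "- 1 < I / Ic" "I / Ic < 1" if "I \<in> {- Ic<..<Ic}" for I
    using that Ic by (simp_all add: field_simps)
  show "(\<lambda>(\<xi>, I). (\<xi>, arcsin (I / Ic))) \<in> UNIV \<times> {- Ic<..<Ic} \<rightarrow> UNIV \<times> {-pi/2<..<pi/2}"
    using arcsin_lt_bounded x by fastforce
  show "action_coordinates \<omega> \<E> ((\<lambda>(\<xi>, I). (\<xi>, arcsin (I / Ic))) y) = y"
    if "y \<in> UNIV \<times> {- Ic<..<Ic}" for y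
  proof (cases y)
    case (Pair \<xi> I)
    then have "sin (arcsin (I / Ic)) = I / Ic" using x[of I] that by (intro sin_arcsin) auto
    then show ?thesis using Ic by (simp add: action_coordinates_def Pair)
  qed
qed (use Ic in \<open>auto simp: action_coordinates_def intro!: arcsin_sin\<close>)

lemma first_return_action_iff:
  assumes I: "I \<in> {- Ic<..<Ic}"
  shows "first_return_action \<omega> \<E> h \<mu> (abs_angle x, I) Y \<longleftrightarrow>
    Y = (abs_angle (x + theta_bar \<omega> \<E> h \<mu> I), I)"
proof -
  define \<alpha> where "\<alpha> = arcsin (I / Ic)"
  have b: "- 1 < I / Ic" "I / Ic < 1" using I Ic by (simp_all add: field_simps)
  have \<alpha>: "\<alpha> \<in> {-pi/2<..<pi/2}" using arcsin_lt_bounded[OF b] by (simp add: \<alpha>_def)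
  have "sin \<alpha> = I / Ic" unfolding \<alpha>_def using b by (intro sin_arcsin) auto
  then have s: "Ic * sin \<alpha> = I" using Ic by simp
  have c: "action_coordinates \<omega> \<E> (\<xi>, \<alpha>) = (\<xi>, I)" for \<xi> by (simp add: action_coordinates_def s)
  have inj: "u = (abs_angle x, \<alpha>)"
    if "u \<in> UNIV \<times> {-pi/2<..<pi/2}" "(abs_angle x, I) = action_coordinates \<omega> \<E> u" for u
    using inj_onD[OF bij_betw_imp_inj_on[OF action_coordinates_bij], of u "(abs_angle x, \<alpha>)"] that c \<alpha> by auto
  have fr: "first_return \<omega> \<E> h \<mu> (abs_angle x, \<alpha>) (\<eta>, \<beta>) \<longleftrightarrow>
      \<beta> = \<alpha> \<and> \<eta> = abs_angle (x + theta_bar \<omega> \<E> h \<mu> I)" for \<eta> \<beta>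
    unfolding first_return_iff[OF \<alpha>] s circle_point_abs_angle cis_mult circle_point_eq_cis_iff ..
  show ?thesis
  proof
    assume "first_return_action \<omega> \<E> h \<mu> (abs_angle x, I) Y"
    then obtain u y where u: "u \<in> UNIV \<times> {-pi/2<..<pi/2}" "(abs_angle x, I) = action_coordinates \<omega> \<E> u"
      and y: "Y = action_coordinates \<omega> \<E> y" "first_return \<omega> \<E> h \<mu> u y"
      unfolding first_return_action_def by blast
    obtain \<eta> \<beta> where "y = (\<eta>, \<beta>)" by (cases y)
    then show "Y = (abs_angle (x + theta_bar \<omega> \<E> h \<mu> I), I)"
      using y inj[OF u] fr c by simp
  next
    assume Y: "Y = (abs_angle (x + theta_bar \<omega> \<E> h \<mu> I), I)"
    show "first_return_action \<omega> \<E> h \<mu> (abs_angle x, I) Y"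
      unfolding first_return_action_def
      by (rule bexI[of _ "(abs_angle x, \<alpha>)"], rule bexI[of _ "(abs_angle (x + theta_bar \<omega> \<E> h \<mu> I), \<alpha>)"])
        (use fr c \<alpha> Y in auto)
  qed
qed

lemma first_return_map_eq:
  assumes "I \<in> {- Ic<..<Ic}"
  shows "first_return_map \<omega> \<E> h \<mu> (abs_angle x, I) = (abs_angle (x + theta_bar \<omega> \<E> h \<mu> I), I)"
  unfolding first_return_map_def first_return_action_iff[OF assms] by simp

text \<open>The tangential component of the momentum is \<open>I\<close> itself. The position does
  not depend on \<open>I\<close>, and its derivative in the angle is the unit tangent, orthogonal to
  the radial part of the momentum derivative; the bracket thus reduces to dI/dI = 1.\<close>

lemma jacobi_momentum_canonical:
  "canonical_coordinates boundary_position (jacobi_momentum \<omega> \<E>) {- Ic<..<Ic}"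
  unfolding canonical_coordinates_def
proof (intro allI ballI)
  fix \<xi> I assume I: "I \<in> {- Ic<..<Ic}"
  have p: "jacobi_momentum \<omega> \<E> x J = cis x * Complex (Ic * cos (arcsin (J / Ic))) (Ic * sin (arcsin (J / Ic)))" for x J
    by (simp add: jacobi_momentum_def V_E_def I_c_def direction_def complex_eq_iff algebra_simps)
  have b: "- 1 < I / Ic" "I / Ic < 1" using I Ic by (simp_all add: field_simps)
  let ?c = "Complex (Ic * cos (arcsin (I / Ic))) (Ic * sin (arcsin (I / Ic)))"
  have cis: "(cis has_vector_derivative \<i> * cis \<xi>) (at \<xi>)"
    unfolding has_vector_derivative_complex_iff by (auto intro!: derivative_eq_intros)
  have "((\<lambda>J. arcsin (J / Ic)) has_real_derivative inverse (sqrt (1 - (I / Ic)\<^sup>2)) * (1 / Ic)) (at I)"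
    by (rule DERIV_chain2[where f = arcsin and g = "\<lambda>J. J / Ic", OF DERIV_arcsin[OF b]]) (use Ic in \<open>auto intro!: derivative_eq_intros\<close>)
  then obtain d where d: "((\<lambda>J. arcsin (J / Ic)) has_real_derivative d) (at I)" by blast
  define k where "k = Ic * (- sin (arcsin (I / Ic)) * d)"
  have dc: "((\<lambda>J. Ic * cos (arcsin (J / Ic))) has_real_derivative k) (at I)"
    unfolding k_def by (intro DERIV_cmult DERIV_chain2[where f = cos, OF DERIV_cos d])
  have "((\<lambda>J. J) has_real_derivative 1) (at I)" by simp
  then have ds: "((\<lambda>J. Ic * sin (arcsin (J / Ic))) has_real_derivative 1) (at I)"
  proof (rule has_field_derivative_transform_within_open[of _ _ _ "{- Ic<..<Ic}"])
    show "J = Ic * sin (arcsin (J / Ic))" if "J \<in> {- Ic<..<Ic}" for J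
      using that Ic by (subst sin_arcsin) (simp_all add: field_simps)
  qed (use I in auto)
  have "((\<lambda>J. Complex (Ic * cos (arcsin (J / Ic))) (Ic * sin (arcsin (J / Ic)))) has_vector_derivative Complex k 1) (at I)"
    unfolding has_vector_derivative_complex_iff using dc ds by simp
  then have pI: "((\<lambda>J. jacobi_momentum \<omega> \<E> \<xi> J) has_vector_derivative cis \<xi> * Complex k 1) (at I)"
    unfolding p by (rule has_vector_derivative_mult_right)
  have px: "((\<lambda>x. jacobi_momentum \<omega> \<E> x I) has_vector_derivative \<i> * cis \<xi> * ?c) (at \<xi>)"
    unfolding p by (intro has_vector_derivative_mult_left cis)
  have "inner (\<i> * cis \<xi>) (cis \<xi> * Complex k 1) = (sin \<xi>)\<^sup>2 + (cos \<xi>)\<^sup>2"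
    by (simp only: inner_complex_def) (simp add: power2_eq_square algebra_simps)
  then have "inner (\<i> * cis \<xi>) (cis \<xi> * Complex k 1) - inner 0 (\<i> * cis \<xi> * ?c) = 1" by simp
  then show "\<exists>q\<^sub>\<xi> q\<^sub>I p\<^sub>\<xi> p\<^sub>I.
        ((\<lambda>x. boundary_position x I) has_vector_derivative q\<^sub>\<xi>) (at \<xi>) \<and>
        ((\<lambda>x. boundary_position \<xi> x) has_vector_derivative q\<^sub>I) (at I) \<and>
        ((\<lambda>x. jacobi_momentum \<omega> \<E> x I) has_vector_derivative p\<^sub>\<xi>) (at \<xi>) \<and>
        ((\<lambda>x. jacobi_momentum \<omega> \<E> \<xi> x) has_vector_derivative p\<^sub>I) (at I) \<and>
        inner q\<^sub>\<xi> p\<^sub>I - inner q\<^sub>I p\<^sub>\<xi> = 1"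
    unfolding boundary_position_def using cis px pI has_vector_derivative_const[of "cis \<xi>" "at I"] by blast
qed

lemma square_less_inner: "x\<^sup>2 < \<E> - \<omega>\<^sup>2 / 2 \<Longrightarrow> x\<^sup>2 < \<E> + h + \<mu>"
proof -
  assume "x\<^sup>2 < \<E> - \<omega>\<^sup>2 / 2"
  also have "\<dots> \<le> \<E>" by simp
  also have "\<E> < \<E> + h + \<mu>" using h \<mu> by simp
  finally show ?thesis .
qed

lemma f_shift_real_analytic: "real_analytic_on (f_shift \<omega> \<E>) {- Ic<..<Ic}"
  by (rule bend_real_analytic[OF energy_pos(1), where c = 1 and s = "\<E> - \<omega>\<^sup>2 / 2"])
    (use f_shift_eq_bend[OF energy_pos(1)] square_less_iff_mem in auto)

lemma g_shift_real_analytic: "real_analytic_on (g_shift \<E> h \<mu>) {- Ic<..<Ic}"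
  by (rule bend_real_analytic[OF \<mu>, where c = "- 2" and s = "\<E> + h + \<mu>"])
    (use g_shift_eq_bend[OF \<mu> square_less_inner] square_less_inner square_less_iff_mem in auto)

lemma card_critical_points_theta_bar:
  shows "finite {I \<in> {- Ic<..<Ic}. deriv (theta_bar \<omega> \<E> h \<mu>) I = 0}"
    and "card {I \<in> {- Ic<..<Ic}. deriv (theta_bar \<omega> \<E> h \<mu>) I = 0} \<le> 10"
proof -
  let ?m = "\<E> - \<omega>\<^sup>2 / 2" and ?n = "\<E> + h + \<mu>"
  let ?D = "\<lambda>x. (2 * \<E> * ?m - 4 * (\<E> - ?m) * x\<^sup>2) / ((\<E>\<^sup>2 + 4 * (?m - \<E>) * x\<^sup>2) * sqrt (?m - x\<^sup>2))
    - 2 * ((2 * \<mu> * ?n - 4 * (\<mu> - ?n) * x\<^sup>2) / ((\<mu>\<^sup>2 + 4 * (?n - \<mu>) * x\<^sup>2) * sqrt (?n - x\<^sup>2)))"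
  have "deriv (theta_bar \<omega> \<E> h \<mu>) x = ?D x" if x: "x \<in> {- Ic<..<Ic}" for x
  proof (rule DERIV_imp_deriv)
    have m: "x\<^sup>2 < ?m" using x square_less_iff_mem by blast
    have "((\<lambda>y. bend \<E> ?m y - 2 * bend \<mu> ?n y) has_real_derivative ?D x) (at x)"
      by (intro DERIV_diff DERIV_cmult bend_has_real_derivative energy_pos \<mu> m square_less_inner)
    then show "(theta_bar \<omega> \<E> h \<mu> has_real_derivative ?D x) (at x)"
    proof (rule has_field_derivative_transform_within_open[of _ _ _ "{- Ic<..<Ic}"])
      show "bend \<E> ?m y - 2 * bend \<mu> ?n y = theta_bar \<omega> \<E> h \<mu> y" if "y \<in> {- Ic<..<Ic}" for y
        using that square_less_iff_mem[of y]
          f_shift_eq_bend[OF energy_pos(1)] g_shift_eq_bend[OF \<mu> square_less_inner]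
        by (simp add: theta_bar_def)
    qed (use x in auto)
  qed
  then have eq: "{I \<in> {- Ic<..<Ic}. deriv (theta_bar \<omega> \<E> h \<mu>) I = 0} = {x. x\<^sup>2 < ?m \<and> ?D x = 0}"
    unfolding square_less_iff_mem by (intro Collect_cong conj_cong) simp_all
  \<comment> \<open>The first inequality is the hypothesis \<open>\<E> > \<omega>\<^sup>2\<close>
    rewritten; it keeps the polynomial nonzero.\<close>
  have "\<E> < 2 * ?m" "\<mu> \<le> ?n" using \<E> h energy_pos by (simp_all add: algebra_simps)
  moreover have "?m \<le> \<E>" by simp
  then have "?m < ?n" using h \<mu> by linarith
  ultimately have "\<E> < 2 * ?m" "?m < ?n" "\<mu> \<le> ?n" by blast+
  note c = card_critical_points_le[OF energy_pos(1) \<mu> this]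
  show "finite {I \<in> {- Ic<..<Ic}. deriv (theta_bar \<omega> \<E> h \<mu>) I = 0}"
    and "card {I \<in> {- Ic<..<Ic}. deriv (theta_bar \<omega> \<E> h \<mu>) I = 0} \<le> 10"
    unfolding eq by (rule c)+
qed

end

theorem theorem1p1:
  fixes \<omega> \<E> h \<mu> :: real
  assumes "\<omega> > 0" and "\<E> > \<omega>\<^sup>2" and "h > 0" and "\<mu> > 0"
  defines "J \<equiv> {- I_c \<omega> \<E> <..< I_c \<omega> \<E>}"
  defines "F \<equiv> first_return_map \<omega> \<E> h \<mu>"
  shows "bij_betw (action_coordinates \<omega> \<E>) (UNIV \<times> {-pi/2<..<pi/2}) (UNIV \<times> J)
    \<and> (\<forall>X\<in>UNIV \<times> J. \<exists>!Y. first_return_action \<omega> \<E> h \<mu> X Y)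
    \<and> F \<in> UNIV \<times> J \<rightarrow> UNIV \<times> J
    \<and> action_angle_coordinates boundary_position (jacobi_momentum \<omega> \<E>) J F
    \<and> (\<forall>\<xi>\<^sub>0. \<forall>I\<^sub>0\<in>J. F (abs_angle \<xi>\<^sub>0, I\<^sub>0) = (abs_angle (\<xi>\<^sub>0 + theta_bar \<omega> \<E> h \<mu> I\<^sub>0), I\<^sub>0))
    \<and> real_analytic_on (f_shift \<omega> \<E>) J
    \<and> real_analytic_on (g_shift \<E> h \<mu>) J
    \<and> finite {I \<in> J. deriv (theta_bar \<omega> \<E> h \<mu>) I = 0}
    \<and> card {I \<in> J. deriv (theta_bar \<omega> \<E> h \<mu>) I = 0} \<le> 10"
proof -
  interpret refraction_billiard \<omega> \<E> h \<mu>
    using assms(1-4) by unfold_locales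
  have F: "F (abs_angle x, I) = (abs_angle (x + theta_bar \<omega> \<E> h \<mu> I), I)" if "I \<in> J" for x I
    using first_return_map_eq that unfolding F_def J_def by blast
  have X: "\<exists>x I. X = (abs_angle x, I) \<and> I \<in> J" if mem: "X \<in> UNIV \<times> J" for X :: "angle \<times> real"
  proof -
    obtain \<xi> I where "X = (\<xi>, I)" "I \<in> J" using mem by (cases X) auto
    moreover obtain x where "\<xi> = abs_angle x" by (rule abs_angle_surj)
    ultimately show ?thesis by blast
  qed
  have ex1: "\<exists>!Y. first_return_action \<omega> \<E> h \<mu> X Y" if mem: "X \<in> UNIV \<times> J" for X
  proof -
    obtain x I where "X = (abs_angle x, I)" "I \<in> J" using X[OF mem] by blast
    then show ?thesis using first_return_action_iff unfolding J_def by simp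
  qed
  have FJ: "F \<in> UNIV \<times> J \<rightarrow> UNIV \<times> J"
  proof
    fix X :: "angle \<times> real" assume "X \<in> UNIV \<times> J"
    then obtain x I where "X = (abs_angle x, I)" "I \<in> J" using X[of X] by blast
    then show "F X \<in> UNIV \<times> J" using F by simp
  qed
  have "\<exists>\<rho>. \<forall>\<xi>. \<forall>I\<in>J. F (abs_angle \<xi>, I) = (abs_angle (\<xi> + \<rho> I), I)"
    using F by (intro exI[of _ "theta_bar \<omega> \<E> h \<mu>"]) simp
  then have aa: "action_angle_coordinates boundary_position (jacobi_momentum \<omega> \<E>) J F"
    unfolding action_angle_coordinates_def using jacobi_momentum_canonical[folded J_def] by simp
  show ?thesis
    by (intro conjI ballI allI action_coordinates_bij[folded J_def] ex1 FJ aa F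
      f_shift_real_analytic[folded J_def] g_shift_real_analytic[folded J_def]
      card_critical_points_theta_bar[folded J_def])
qed

end
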